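(* For every non-constant monotone graph property $P$ on $n$-vertex directed graphs, $Q_0(P)\in\Omega(n)$. Moreover, there is a non-constant monotone graph property $P$ such that $Q_0(P)\in O(n^{3/2})$ and $R_2(P)\in\Omega(n^2)$.
   Context: An $n$-vertex directed graph is represented by $N=n(n-1)$ bits, one per possible edge $(i,j)$, $i\ne j$. A graph property is a function $P:\{0,1\}^{n(n-1)}\to\{0,1\}$ invariant under permutations of the vertices; it is monotone if adding edges cannot change the value from 1 to 0, and non-constant if it takes both values. In the quantum query model the input bits are accessed only via the gate $|j,b\rangle\mapsto|j,b\oplus x_j\rangle$. $Q_0(P)$ is the minimal worst-case number of queries of a zero-error quantum algorithm: on each input it outputs $P(x)$ or "don't know", never a wrong value, and "don't know" with probability $\le 1/2$. $R_2(P)$ is the minimal worst-case number of queries of a classical randomized decision tree that outputs $P(x)$ with probability $\ge 2/3$ on every input. *)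

theory Defs
  imports
    Complex_Main
    "HOL-Library.Landau_Symbols"
    "HOL-Combinatorics.Permutations"
    "HOL-Probability.Probability_Mass_Function"
begin

text \<open>
  Bit strings indexed by a finite set \<open>I\<close> are represented by subsets \<open>x \<subseteq> I\<close>: the bit \<open>x\<^sub>j\<close> is 1
  iff \<open>j \<in> x\<close>. A function on \<open>I\<close>-indexed bit strings is an \<open>f :: 'i set \<Rightarrow> bool\<close>, of which only the
  values on subsets of \<open>I\<close> matter.
\<close>

subsection \<open>Properties of directed graphs\<close>

definition edges :: "nat \<Rightarrow> (nat \<times> nat) set" where
  "edges n = {(i, j). i < n \<and> j < n \<and> i \<noteq> j}"

definition graph_property :: "nat \<Rightarrow> ((nat \<times> nat) set \<Rightarrow> bool) \<Rightarrow> bool" where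
  "graph_property n P \<longleftrightarrow>
     (\<forall>\<pi> G. \<pi> permutes {..<n} \<longrightarrow> G \<subseteq> edges n \<longrightarrow> P (map_prod \<pi> \<pi> ` G) = P G)"

definition monotone_property :: "nat \<Rightarrow> ((nat \<times> nat) set \<Rightarrow> bool) \<Rightarrow> bool" where
  "monotone_property n P \<longleftrightarrow> (\<forall>G H. G \<subseteq> H \<longrightarrow> H \<subseteq> edges n \<longrightarrow> P G \<longrightarrow> P H)"

definition nonconstant_property :: "nat \<Rightarrow> ((nat \<times> nat) set \<Rightarrow> bool) \<Rightarrow> bool" where
  "nonconstant_property n P \<longleftrightarrow> (\<exists>G\<subseteq>edges n. P G) \<and> (\<exists>H\<subseteq>edges n. \<not> P H)"

definition nonconstant_monotone_graph_property :: "nat \<Rightarrow> ((nat \<times> nat) set \<Rightarrow> bool) \<Rightarrow> bool" where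
  "nonconstant_monotone_graph_property n P \<longleftrightarrow>
     graph_property n P \<and> monotone_property n P \<and> nonconstant_property n P"


subsection \<open>Quantum query algorithms\<close>

text \<open>
  The computational basis consists of the states \<open>|j,b,z\<rangle>\<close> where \<open>j \<in> I\<close> is the query register,
  \<open>b\<close> the answer bit and \<open>z < w\<close> a workspace of arbitrary finite dimension \<open>w\<close>. State vectors and
  matrices are given by their entries with respect to this basis.
\<close>

type_synonym 'i qbasis = "'i \<times> bool \<times> nat"
type_synonym 'i qstate = "'i qbasis \<Rightarrow> complex"
type_synonym 'i qmatrix = "'i qbasis \<Rightarrow> 'i qbasis \<Rightarrow> complex"

definition qbasis :: "'i set \<Rightarrow> nat \<Rightarrow> 'i qbasis set" where
  "qbasis I w = I \<times> UNIV \<times> {..<w}"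

text \<open>Since the basis \<open>B\<close> is finite, \<open>U\<^sup>* U = 1\<close> already implies \<open>U U\<^sup>* = 1\<close>.\<close>

definition unitary_on :: "'i qbasis set \<Rightarrow> 'i qmatrix \<Rightarrow> bool" where
  "unitary_on B U \<longleftrightarrow>
     (\<forall>s\<in>B. \<forall>t\<in>B. (\<Sum>r\<in>B. cnj (U r s) * U r t) = (if s = t then 1 else 0))"

definition apply_matrix :: "'i qbasis set \<Rightarrow> 'i qmatrix \<Rightarrow> 'i qstate \<Rightarrow> 'i qstate" where
  "apply_matrix B U \<psi> = (\<lambda>s. \<Sum>t\<in>B. U s t * \<psi> t)"

text \<open>
  The linear extension of \<open>|j,b,z\<rangle> \<mapsto> |j,b \<oplus> x\<^sub>j,z\<rangle>\<close>. This basis permutation is an involution, so the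
  new amplitude of \<open>|j,b,z\<rangle>\<close> is the old amplitude of \<open>|j,b \<oplus> x\<^sub>j,z\<rangle>\<close>; exclusive or is \<open>\<noteq>\<close> on \<open>bool\<close>.
\<close>

definition query_gate :: "'i set \<Rightarrow> 'i qstate \<Rightarrow> 'i qstate" where
  "query_gate x \<psi> = (\<lambda>(j, b, z). \<psi> (j, b \<noteq> (j \<in> x), z))"

text \<open>
  An algorithm starts in a fixed basis state and applies \<open>U\<^sub>T O\<^sub>x U\<^sub>T\<^sub>-\<^sub>1 O\<^sub>x \<dots> O\<^sub>x U\<^sub>0\<close>, where the unitaries
  \<open>U\<^sub>k\<close> do not depend on the input \<open>x\<close> and \<open>O\<^sub>x\<close> is the query gate. The final state is measured in
  the computational basis and the output is a function of the result; \<open>None\<close> means "don't know".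
\<close>

record 'i qalg =
  num_queries :: nat
  work_dim :: nat
  start_state :: "'i qbasis"
  unitaries :: "nat \<Rightarrow> 'i qmatrix"
  result :: "'i qbasis \<Rightarrow> bool option"

definition alg_basis :: "'i set \<Rightarrow> 'i qalg \<Rightarrow> 'i qbasis set" where
  "alg_basis I A = qbasis I (work_dim A)"

definition is_qalg :: "'i set \<Rightarrow> 'i qalg \<Rightarrow> bool" where
  "is_qalg I A \<longleftrightarrow>
     start_state A \<in> alg_basis I A \<and>
     (\<forall>k\<le>num_queries A. unitary_on (alg_basis I A) (unitaries A k))"

primrec state_after :: "'i set \<Rightarrow> 'i qalg \<Rightarrow> 'i set \<Rightarrow> nat \<Rightarrow> 'i qstate" where
  "state_after I A x 0 =
     apply_matrix (alg_basis I A) (unitaries A 0) (\<lambda>s. if s = start_state A then 1 else 0)"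
| "state_after I A x (Suc k) =
     apply_matrix (alg_basis I A) (unitaries A (Suc k)) (query_gate x (state_after I A x k))"

definition output_prob :: "'i set \<Rightarrow> 'i qalg \<Rightarrow> 'i set \<Rightarrow> bool option \<Rightarrow> real" where
  "output_prob I A x v =
     (\<Sum>s | s \<in> alg_basis I A \<and> result A s = v. (cmod (state_after I A x (num_queries A) s))\<^sup>2)"

definition zero_error_computes :: "'i set \<Rightarrow> 'i qalg \<Rightarrow> ('i set \<Rightarrow> bool) \<Rightarrow> bool" where
  "zero_error_computes I A f \<longleftrightarrow>
     (\<forall>x\<subseteq>I. output_prob I A x (Some (\<not> f x)) = 0 \<and> output_prob I A x None \<le> 1 / 2)"

text \<open>
  For finite nonempty \<open>I\<close> querying all bits computes \<open>f\<close>, so the minimum exists. For \<open>I = {}\<close> the basis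
  is empty, there is no algorithm, and the value is meaningless.
\<close>

definition Q0 :: "'i set \<Rightarrow> ('i set \<Rightarrow> bool) \<Rightarrow> nat" where
  "Q0 I f = (LEAST T. \<exists>A. is_qalg I A \<and> num_queries A = T \<and> zero_error_computes I A f)"


subsection \<open>Randomized decision trees\<close>

datatype 'i dtree = Leaf bool | Query 'i "'i dtree" "'i dtree"

primrec queried :: "'i dtree \<Rightarrow> 'i set" where
  "queried (Leaf b) = {}"
| "queried (Query j t0 t1) = insert j (queried t0 \<union> queried t1)"

primrec dtree_value :: "'i dtree \<Rightarrow> 'i set \<Rightarrow> bool" where
  "dtree_value (Leaf b) x = b"
| "dtree_value (Query j t0 t1) x = (if j \<in> x then dtree_value t1 x else dtree_value t0 x)"

primrec dtree_cost :: "'i dtree \<Rightarrow> 'i set \<Rightarrow> nat" where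
  "dtree_cost (Leaf b) x = 0"
| "dtree_cost (Query j t0 t1) x = Suc (if j \<in> x then dtree_cost t1 x else dtree_cost t0 x)"

text \<open>
  A randomized decision tree is a probability distribution over deterministic ones; its worst-case
  number of queries is taken over all inputs and all trees of positive probability.
\<close>

definition is_rdtree :: "'i set \<Rightarrow> 'i dtree pmf \<Rightarrow> bool" where
  "is_rdtree I D \<longleftrightarrow> (\<forall>t\<in>set_pmf D. queried t \<subseteq> I)"

definition rdtree_cost_le :: "'i set \<Rightarrow> 'i dtree pmf \<Rightarrow> nat \<Rightarrow> bool" where
  "rdtree_cost_le I D T \<longleftrightarrow> (\<forall>t\<in>set_pmf D. \<forall>x\<subseteq>I. dtree_cost t x \<le> T)"

definition bounded_error_computes :: "'i set \<Rightarrow> 'i dtree pmf \<Rightarrow> ('i set \<Rightarrow> bool) \<Rightarrow> bool" where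
  "bounded_error_computes I D f \<longleftrightarrow>
     (\<forall>x\<subseteq>I. measure_pmf.prob D {t. dtree_value t x = f x} \<ge> 2 / 3)"

definition R2 :: "'i set \<Rightarrow> ('i set \<Rightarrow> bool) \<Rightarrow> nat" where
  "R2 I f = (LEAST T. \<exists>D. is_rdtree I D \<and> rdtree_cost_le I D T \<and> bounded_error_computes I D f)"

end

theory Submission
  imports Defs
begin

text \<open>
  Lower bound: let \<open>G\<close> be a minimal graph with the property and \<open>L\<close> a minimal set of edges whose complement
  lacks it. Every copy of \<open>G\<close> meets \<open>L\<close>, so averaging over the vertex permutations gives
  \<open>|G| |L| \<ge> n (n - 1)\<close>. On the subsets of \<open>G\<close> the property is a conjunction of \<open>|G|\<close> bits; an amplitude of
  a zero-error algorithm leading to the answer 1 is a polynomial of degree at most \<open>T\<close> that vanishes on all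
  inputs but one, so \<open>T \<ge> |G|\<close>. Dually, \<open>T \<ge> |L|\<close>.

  Separation: the property says that some vertex has edges to all others. Going through the rows of the
  adjacency matrix, search a missing edge by \<open>O(\<surd>n)\<close> Grover iterations and move to the next row when one is
  found. After \<open>O(n)\<close> searches either all rows are known to have a missing edge, or the current row is
  probably full, which \<open>n - 1\<close> queries verify. A randomized decision tree must distinguish a graph with one
  missing edge per row, in random position, from the graphs obtained by adding one of them; for this it
  has to find a third of the missing edges, at a cost of order \<open>n\<close> queries each.
\<close>

section \<open>Gram matrices of query algorithms\<close>

text \<open>The separating algorithm is a loop of searches controlled by their own outcomes; writing
  out its unitaries would mean tracking every register. But families of states \<open>psi x\<close>,
  \<open>phi x\<close> with the same inner products differ by an orthogonal map that does not depend
  on \<open>x\<close>, so the Gram matrix over all inputs is the only information about the states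
  that matters. Algorithms are therefore composed as kernels: sums are branches in orthogonal
  subspaces, products are tensor products, and a query changes signs. Circuits for such kernels are
  built once and for all in \<open>reach_realize\<close>. Real amplitudes suffice there; the lower
  bound covers all complex algorithms.

  Zero error comes from certificates: a row is left only after a queried missing edge, and a full
  row is announced only after all its bits are read. So bad luck can only cause "don't know". A
  search of a row with a missing edge succeeds with probability at least 1/8, so 8n searches are
  expected to suffice, and 16n leave a failure probability of at most 1/2.\<close>

definition gram_inner :: "'b set \<Rightarrow> ('b \<Rightarrow> real) \<Rightarrow> ('b \<Rightarrow> real) \<Rightarrow> real" where
  "gram_inner B u v = (\<Sum>s\<in>B. u s * v s)"

definition orthogonal_on :: "'b set \<Rightarrow> ('b \<Rightarrow> 'b \<Rightarrow> real) \<Rightarrow> bool" where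
  "orthogonal_on B U \<longleftrightarrow> (\<forall>s\<in>B. \<forall>t\<in>B. (\<Sum>r\<in>B. U r s * U r t) = (if s = t then 1 else 0))"

lemma gram_inner_orthogonal:
  assumes "finite B" and U: "orthogonal_on B U"
  shows "gram_inner B (\<lambda>s. \<Sum>t\<in>B. U s t * u t) (\<lambda>s. \<Sum>t\<in>B. U s t * v t) = gram_inner B u v"
proof -
  have "gram_inner B (\<lambda>s. \<Sum>t\<in>B. U s t * u t) (\<lambda>s. \<Sum>t\<in>B. U s t * v t)
      = (\<Sum>s\<in>B. \<Sum>t\<in>B. \<Sum>t'\<in>B. (U s t * U s t') * (u t * v t'))"
    by (simp add: gram_inner_def sum_product algebra_simps)
  also have "\<dots> = (\<Sum>t\<in>B. \<Sum>t'\<in>B. \<Sum>s\<in>B. (U s t * U s t') * (u t * v t'))"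
    by (subst sum.swap, rule sum.cong[OF refl], rule sum.swap)
  also have "\<dots> = (\<Sum>t\<in>B. \<Sum>t'\<in>B. (if t = t' then 1 else 0) * (u t * v t'))"
    using U by (intro sum.cong refl) (simp add: orthogonal_on_def flip: sum_distrib_right)
  also have "\<dots> = (\<Sum>t\<in>B. \<Sum>t'\<in>B. if t = t' then u t * v t' else 0)"
    by (intro sum.cong refl) simp
  also have "\<dots> = gram_inner B u v"
    using \<open>finite B\<close> by (simp add: gram_inner_def)
  finally show ?thesis .
qed

text \<open>One Householder reflection per vector: the difference of the current image and the target is
  orthogonal to all targets that are already attained.\<close>

lemma orthogonal_map_exists:
  assumes "finite B" "finite X"
    and "\<forall>x\<in>X. \<forall>y\<in>X. gram_inner B (u x) (u y) = gram_inner B (v x) (v y)"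
  shows "\<exists>U. orthogonal_on B U \<and> (\<forall>x\<in>X. \<forall>s\<in>B. (\<Sum>t\<in>B. U s t * u x t) = v x s)"
  using assms(2,3)
proof (induction X rule: finite_induct)
  case empty
  have "(\<Sum>r\<in>B. (if r = s then 1 else 0) * (if r = t then 1 else 0)) = (if s = t then 1 else (0::real))"
    if "s \<in> B" for s t
  proof -
    have "(\<Sum>r\<in>B. (if r = s then 1 else 0) * (if r = t then 1 else 0)) =
          (\<Sum>r\<in>B. if r = s then (if s = t then 1 else 0) else (0::real))"
      by (rule sum.cong) auto
    then show ?thesis using that \<open>finite B\<close> by simp
  qed
  then show ?case
    by (intro exI[of _ "\<lambda>s t. if s = t then 1 else 0"]) (simp add: orthogonal_on_def)
next
  case (insert y X)
  then obtain U where U: "orthogonal_on B U"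
    and Uu: "\<And>x s. x \<in> X \<Longrightarrow> s \<in> B \<Longrightarrow> (\<Sum>t\<in>B. U s t * u x t) = v x s"
    by (metis insertCI)
  define a where "a x s = (\<Sum>t\<in>B. U s t * u x t)" for x s
  define d where "d s = a y s - v y s" for s
  define D where "D = gram_inner B d d"
  have a_gram: "gram_inner B (a x) (a x') = gram_inner B (u x) (u x')" for x x'
    unfolding a_def by (rule gram_inner_orthogonal[OF assms(1) U])
  have av: "a x s = v x s" if "x \<in> X" "s \<in> B" for x s
    using Uu[OF that] by (simp add: a_def)
  have d_orth: "gram_inner B d (a x) = 0" if "x \<in> X" for x
  proof -
    have "gram_inner B d (a x) = gram_inner B (a y) (a x) - gram_inner B (v y) (a x)"
      by (simp add: gram_inner_def d_def sum_subtractf algebra_simps)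
    also have "gram_inner B (v y) (a x) = gram_inner B (v y) (v x)"
      unfolding gram_inner_def by (intro sum.cong refl) (simp add: av that)
    also have "gram_inner B (a y) (a x) = gram_inner B (v y) (v x)"
      using insert.prems that by (simp add: a_gram)
    finally show ?thesis by simp
  qed
  \<comment> \<open>Since \<open>a y\<close> and \<open>v y\<close> have the same length, their
    midpoint is orthogonal to \<open>d\<close>; so reflecting along \<open>d\<close> exchanges
    them.\<close>
  have d_y: "2 * gram_inner B d (a y) = D"
  proof -
    have "gram_inner B (a y) (a y) = gram_inner B (v y) (v y)"
      using insert.prems by (simp add: a_gram)
    moreover have "D = gram_inner B (a y) (a y) - 2 * gram_inner B (v y) (a y) + gram_inner B (v y) (v y)"
      by (simp add: D_def gram_inner_def d_def sum_subtractf sum.distrib sum_distrib_left algebra_simps)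
    moreover have "gram_inner B d (a y) = gram_inner B (a y) (a y) - gram_inner B (v y) (a y)"
      by (simp add: gram_inner_def d_def sum_subtractf algebra_simps)
    ultimately show ?thesis by linarith
  qed
  show ?case
  proof (cases "D = 0")
    case True
    then have "\<forall>s\<in>B. d s = 0"
      using \<open>finite B\<close> by (auto simp: D_def gram_inner_def sum_nonneg_eq_0_iff)
    then have "\<forall>s\<in>B. a y s = v y s" by (simp add: d_def)
    then show ?thesis using U av by (auto simp: a_def)
  next
    case False
    define g where "g t = (\<Sum>r\<in>B. d r * U r t)" for t
    \<comment> \<open>\<open>g\<close> is the transpose of \<open>U\<close> applied to
      \<open>d\<close>, so \<open>V\<close> is \<open>U\<close> followed by the reflection that
      negates \<open>d\<close>.\<close>
    define V where "V s t = U s t - 2 / D * d s * g t" for s t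
    have "orthogonal_on B V"
      unfolding orthogonal_on_def
    proof (intro ballI)
      fix s t assume st: "s \<in> B" "t \<in> B"
      have "(\<Sum>r\<in>B. V r s * V r t) =
         (\<Sum>r\<in>B. U r s * U r t - 2 / D * g t * (d r * U r s) - 2 / D * g s * (d r * U r t)
            + (2 / D)\<^sup>2 * g s * g t * (d r * d r))"
        by (intro sum.cong refl) (simp add: V_def algebra_simps power2_eq_square)
      also have "\<dots> = (\<Sum>r\<in>B. U r s * U r t) - 2 / D * g t * g s - 2 / D * g s * g t
            + (2 / D)\<^sup>2 * g s * g t * D"
        by (simp only: sum.distrib sum_subtractf sum_distrib_left[symmetric] g_def D_def gram_inner_def)
      also have "\<dots> = (\<Sum>r\<in>B. U r s * U r t)"
        using False by (simp add: power2_eq_square field_simps)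
      finally show "(\<Sum>r\<in>B. V r s * V r t) = (if s = t then 1 else 0)"
        using U st by (simp add: orthogonal_on_def)
    qed
    moreover have "(\<Sum>t\<in>B. V s t * u x t) = v x s" if x: "x \<in> insert y X" and "s \<in> B" for x s
    proof -
      have "(\<Sum>t\<in>B. g t * u x t) = (\<Sum>t\<in>B. \<Sum>r\<in>B. d r * (U r t * u x t))"
        by (simp add: g_def sum_distrib_right mult.assoc)
      also have "\<dots> = gram_inner B d (a x)"
        by (subst sum.swap) (simp add: gram_inner_def a_def sum_distrib_left)
      finally have g: "(\<Sum>t\<in>B. g t * u x t) = gram_inner B d (a x)" .
      have "(\<Sum>t\<in>B. V s t * u x t) = (\<Sum>t\<in>B. U s t * u x t - 2 / D * d s * (g t * u x t))"
        by (intro sum.cong refl) (simp add: V_def algebra_simps)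
      also have "\<dots> = a x s - 2 / D * d s * gram_inner B d (a x)"
        by (simp only: sum_subtractf sum_distrib_left[symmetric] g) (simp add: a_def)
      also have "\<dots> = v x s"
      proof (cases "x = y")
        case True
        have "2 / D * d s * gram_inner B d (a y) = d s * (2 * gram_inner B d (a y)) / D" by simp
        also have "\<dots> = d s" using False by (simp add: d_y)
        finally show ?thesis by (simp add: True d_def)
      next
        case False
        then show ?thesis using x d_orth av \<open>s \<in> B\<close> by auto
      qed
      finally show ?thesis .
    qed
    ultimately show ?thesis by blast
  qed
qed

section \<open>Positive semidefinite kernels\<close>

text \<open>An explicit factorization instead of nonnegative quadratic forms: the factors
  \<open>a l x\<close> later serve as amplitudes of the state on input \<open>x\<close>.\<close>

definition psd_kernel :: "('x \<Rightarrow> 'x \<Rightarrow> real) \<Rightarrow> bool" where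
  "psd_kernel M \<longleftrightarrow> (\<exists>w a. \<forall>x y. M x y = (\<Sum>l<(w::nat). a l x * a l y))"

lemma psd_kernel_pad:
  assumes "psd_kernel M"
  shows "\<exists>w0. \<forall>w\<ge>w0. \<exists>a. \<forall>x y. M x y = (\<Sum>l<(w::nat). a l x * a l y)"
proof -
  from assms obtain w0 a where a: "\<And>x y. M x y = (\<Sum>l<(w0::nat). a l x * a l y)"
    by (auto simp: psd_kernel_def)
  have "\<exists>a. \<forall>x y. M x y = (\<Sum>l<w. a l x * a l y)" if "w \<ge> w0" for w
  proof (intro exI allI)
    fix x y
    have "(\<Sum>l<w. (if l < w0 then a l x else 0) * (if l < w0 then a l y else 0)) =
          (\<Sum>l<w0. a l x * a l y)"
      using that by (intro sum.mono_neutral_cong_right) auto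
    then show "M x y = (\<Sum>l<w. (if l < w0 then a l x else 0) * (if l < w0 then a l y else 0))"
      by (simp add: a)
  qed
  then show ?thesis by blast
qed

lemma psd_kernelI:
  assumes "finite S" "\<And>x y. M x y = (\<Sum>s\<in>S. a s x * a s y)"
  shows "psd_kernel M"
proof -
  obtain h where h: "bij_betw h {..<card S} S"
    using ex_bij_betw_nat_finite[OF assms(1)] by (auto simp: atLeast0LessThan)
  have "M x y = (\<Sum>l<card S. a (h l) x * a (h l) y)" for x y
    using sum.reindex_bij_betw[OF h, of "\<lambda>s. a s x * a s y"] by (simp add: assms(2))
  then show ?thesis
    unfolding psd_kernel_def by (intro exI[of _ "card S"] exI[of _ "\<lambda>l. a (h l)"]) simp
qed

lemma psd_kernel_rank1: "psd_kernel (\<lambda>x y. a x * a y)"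
  by (rule psd_kernelI[of "{()}" _ "\<lambda>_. a"]) auto

lemma psd_kernel_const: "c \<ge> 0 \<Longrightarrow> psd_kernel (\<lambda>x y. c)"
  using psd_kernel_rank1[of "\<lambda>_. sqrt c"] by simp

lemma psd_kernel_sum:
  assumes "finite S" "\<And>s. s \<in> S \<Longrightarrow> psd_kernel (M s)"
  shows "psd_kernel (\<lambda>x y. \<Sum>s\<in>S. M s x y)"
proof -
  have "\<forall>s\<in>S. \<exists>wa. \<forall>x y. M s x y = (\<Sum>l<fst wa. snd wa (l::nat) x * snd wa l y)"
    using assms(2) by (auto simp: psd_kernel_def)
  then obtain wa where wa: "\<And>s x y. s \<in> S \<Longrightarrow> M s x y = (\<Sum>l<fst (wa s). snd (wa s) (l::nat) x * snd (wa s) l y)"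
    by metis
  show ?thesis
    by (rule psd_kernelI[of "SIGMA s:S. {..<fst (wa s)}" _ "\<lambda>(s, l). snd (wa s) l"])
       (simp_all add: wa sum.Sigma assms(1) case_prod_unfold)
qed

lemma psd_kernel_add:
  assumes "psd_kernel M" "psd_kernel N"
  shows "psd_kernel (\<lambda>x y. M x y + N x y)"
  using psd_kernel_sum[of "UNIV :: bool set" "\<lambda>b. if b then M else N"] assms
  by (simp add: UNIV_bool add.commute)

text \<open>Schur product theorem: the entrywise product is the Gram matrix of the tensor products
  of the vectors.\<close>

lemma psd_kernel_mult:
  assumes "psd_kernel M" "psd_kernel N"
  shows "psd_kernel (\<lambda>x y. M x y * N x y)"
proof -
  from assms obtain v w a b where
    "\<And>x y. M x y = (\<Sum>l<(v::nat). a l x * a l y)" "\<And>x y. N x y = (\<Sum>l<(w::nat). b l x * b l y)"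
    by (auto simp: psd_kernel_def)
  then show ?thesis
    by (intro psd_kernelI[of "{..<v} \<times> {..<w}" _ "\<lambda>(k, l) x. a k x * b l x"])
       (simp_all add: sum_product sum.cartesian_product case_prod_unfold algebra_simps)
qed

section \<open>Query algorithms as Gram matrices, and their composition\<close>

text \<open>Phase kickback: the eigenvalue of a query to \<open>i\<close> when the answer bit is in
  the state (|0> - |1>) / sqrt 2.\<close>

definition phase :: "'i \<Rightarrow> 'i set \<Rightarrow> real" where
  "phase i x = (if i \<in> x then -1 else 1)"

text \<open>The Gram matrices of the states, one for each input, of an algorithm after \<open>T\<close> queries.
  Before a query, \<open>A\<close> is the contribution of the idle part of the states and \<open>M i\<close> that of the part
  querying \<open>i\<close>, with the answer bit in the state \<open>(|0\<rangle> + |1\<rangle>) / \<surd>2\<close> and \<open>(|0\<rangle> - |1\<rangle>) / \<surd>2\<close>, respectively.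
  Unitaries, which preserve the Gram matrix, are left implicit.\<close>

inductive reach :: "'i set \<Rightarrow> nat \<Rightarrow> ('i set \<Rightarrow> 'i set \<Rightarrow> real) \<Rightarrow> bool" for I where
  reach_0: "reach I 0 (\<lambda>_ _. 1)"
| reach_Suc: "reach I T (\<lambda>x y. A x y + (\<Sum>i\<in>I. M i x y)) \<Longrightarrow> psd_kernel A \<Longrightarrow>
    (\<And>i. i \<in> I \<Longrightarrow> psd_kernel (M i)) \<Longrightarrow>
    reach I (Suc T) (\<lambda>x y. A x y + (\<Sum>i\<in>I. phase i x * phase i y * M i x y))"

text \<open>Branch \<open>s\<close> of the first algorithm is tensored with the states of its own
  continuation \<open>K s\<close>. All branches query in superposition, so the extra cost is
  \<open>T'\<close> and not \<open>T'\<close> per branch. The induction splits the last query off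
  every \<open>K s\<close> and merges idle parts with idle parts and query parts with query
  parts.\<close>

lemma reach_mix:
  assumes "reach I T (\<lambda>x y. \<Sum>s\<in>S. M s x y)" "finite I" "finite S"
    and "\<And>s. s \<in> S \<Longrightarrow> psd_kernel (M s)" "\<And>s. s \<in> S \<Longrightarrow> reach I T' (K s)"
  shows "reach I (T + T') (\<lambda>x y. \<Sum>s\<in>S. M s x y * K s x y)"
  using assms(5)
proof (induction T' arbitrary: K)
  case 0
  have "K s = (\<lambda>_ _. 1)" if "s \<in> S" for s
    using 0[OF that] by (auto elim: reach.cases)
  then show ?case using assms(1) by simp
next
  case (Suc T')
  let ?Q = "\<lambda>s AN. reach I T' (\<lambda>x y. fst AN x y + (\<Sum>i\<in>I. snd AN i x y)) \<and> psd_kernel (fst AN) \<and>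
     (\<forall>i\<in>I. psd_kernel (snd AN i)) \<and>
     K s = (\<lambda>x y. fst AN x y + (\<Sum>i\<in>I. phase i x * phase i y * snd AN i x y))"
  have "\<exists>AN. ?Q s AN" if "s \<in> S" for s
    using Suc.prems[OF that] by (cases rule: reach.cases) auto
  then have "\<forall>s\<in>S. \<exists>AN. ?Q s AN" by blast
  from bchoice[OF this] obtain AN where "\<forall>s\<in>S. ?Q s (AN s)" by blast
  then have AN: "\<And>s. s \<in> S \<Longrightarrow> reach I T' (\<lambda>x y. fst (AN s) x y + (\<Sum>i\<in>I. snd (AN s) i x y))"
     "\<And>s. s \<in> S \<Longrightarrow> psd_kernel (fst (AN s))" "\<And>s i. s \<in> S \<Longrightarrow> i \<in> I \<Longrightarrow> psd_kernel (snd (AN s) i)"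
     "\<And>s. s \<in> S \<Longrightarrow> K s = (\<lambda>x y. fst (AN s) x y + (\<Sum>i\<in>I. phase i x * phase i y * snd (AN s) i x y))"
    by blast+
  have "reach I (T + T') (\<lambda>x y. \<Sum>s\<in>S. M s x y * (fst (AN s) x y + (\<Sum>i\<in>I. snd (AN s) i x y)))"
    by (rule Suc.IH) (rule AN(1))
  also have "(\<lambda>x y. \<Sum>s\<in>S. M s x y * (fst (AN s) x y + (\<Sum>i\<in>I. snd (AN s) i x y))) =
     (\<lambda>x y. (\<Sum>s\<in>S. M s x y * fst (AN s) x y) + (\<Sum>i\<in>I. \<Sum>s\<in>S. M s x y * snd (AN s) i x y))"
    by (subst sum.swap) (simp add: algebra_simps sum.distrib sum_distrib_left)
  finally have "reach I (Suc (T + T')) (\<lambda>x y. (\<Sum>s\<in>S. M s x y * fst (AN s) x y) +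
     (\<Sum>i\<in>I. phase i x * phase i y * (\<Sum>s\<in>S. M s x y * snd (AN s) i x y)))"
    using assms AN by (intro reach_Suc psd_kernel_sum psd_kernel_mult) auto
  also have "(\<lambda>x y. (\<Sum>s\<in>S. M s x y * fst (AN s) x y) +
     (\<Sum>i\<in>I. phase i x * phase i y * (\<Sum>s\<in>S. M s x y * snd (AN s) i x y))) =
     (\<lambda>x y. \<Sum>s\<in>S. M s x y * K s x y)"
    by (intro ext, simp add: AN(4) algebra_simps sum.distrib sum_distrib_left, rule sum.swap)
  finally show ?case by simp
qed

lemma reach_psd:
  assumes "reach I T K" "finite I" shows "psd_kernel K"
  using assms(1)
proof cases
  case reach_0
  then show ?thesis by (simp add: psd_kernel_const)
next
  case (reach_Suc T A M)
  show ?thesis unfolding reach_Suc(2) using reach_Suc assms(2)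
    by (intro psd_kernel_add psd_kernel_sum psd_kernel_mult psd_kernel_rank1) auto
qed

text \<open>A query is wasted by putting the whole state into the idle part.\<close>

lemma reach_idle:
  assumes "reach I T K" "finite I" "T \<le> T'" shows "reach I T' K"
  using assms(3)
proof (induction rule: dec_induct)
  case base
  then show ?case by (rule assms)
next
  case (step T')
  have "reach I (Suc T') (\<lambda>x y. K x y + (\<Sum>i\<in>I. phase i x * phase i y * 0))"
    using step.IH reach_psd[OF step.IH assms(2)]
    by (intro reach_Suc) (simp_all add: psd_kernel_const)
  then show ?case by simp
qed

text \<open>\<open>M v\<close> is the Gram matrix of the components of the final states that give the outcome \<open>v\<close>, so its
  diagonal consists of the probabilities \<open>p x v\<close> of this outcome on input \<open>x\<close>.\<close>

definition runs :: "'i set \<Rightarrow> nat \<Rightarrow> 'v set \<Rightarrow> ('i set \<Rightarrow> 'v \<Rightarrow> real) \<Rightarrow> bool" where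
  "runs I T V p \<longleftrightarrow> (\<exists>M. reach I T (\<lambda>x y. \<Sum>v\<in>V. M v x y) \<and>
     (\<forall>v\<in>V. psd_kernel (M v) \<and> (\<forall>x. M v x x = p x v)))"

lemma runs_idle:
  assumes "runs I T V p" "finite I" "T \<le> T'" shows "runs I T' V p"
  using assms reach_idle unfolding runs_def by blast

lemma runs_cong:
  assumes "runs I T V p" "\<And>x v. v \<in> V \<Longrightarrow> p x v = q x v" shows "runs I T V q"
  using assms unfolding runs_def by auto

lemma runs_bind:
  assumes "runs I T V p" "\<And>v. v \<in> V \<Longrightarrow> runs I T' W (q v)" "finite I" "finite V" "finite W"
  shows "runs I (T + T') W (\<lambda>x w. \<Sum>v\<in>V. p x v * q v x w)"
proof -
  obtain M where M: "reach I T (\<lambda>x y. \<Sum>v\<in>V. M v x y)" "\<And>v. v \<in> V \<Longrightarrow> psd_kernel (M v)"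
    "\<And>v x. v \<in> V \<Longrightarrow> M v x x = p x v"
    using assms(1) by (auto simp: runs_def)
  obtain N where N: "\<And>v. v \<in> V \<Longrightarrow> reach I T' (\<lambda>x y. \<Sum>w\<in>W. N v w x y)"
    "\<And>v w. v \<in> V \<Longrightarrow> w \<in> W \<Longrightarrow> psd_kernel (N v w)" "\<And>v w x. v \<in> V \<Longrightarrow> w \<in> W \<Longrightarrow> N v w x x = q v x w"
    using assms(2) unfolding runs_def by metis
  have "reach I (T + T') (\<lambda>x y. \<Sum>v\<in>V. M v x y * (\<Sum>w\<in>W. N v w x y))"
    by (rule reach_mix) (use assms M N in auto)
  also have "(\<lambda>x y. \<Sum>v\<in>V. M v x y * (\<Sum>w\<in>W. N v w x y)) =
     (\<lambda>x y. \<Sum>w\<in>W. \<Sum>v\<in>V. M v x y * N v w x y)"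
    by (intro ext, simp add: sum_distrib_left, rule sum.swap)
  finally show ?thesis
    unfolding runs_def using assms M N
    by (intro exI[of _ "\<lambda>w x y. \<Sum>v\<in>V. M v x y * N v w x y"]) (auto intro!: psd_kernel_sum psd_kernel_mult)
qed

text \<open>A random choice is a superposition with amplitudes \<open>sqrt (c v)\<close>, prepared
  without queries.\<close>

lemma runs_random:
  assumes "\<And>v. v \<in> V \<Longrightarrow> 0 \<le> c v" "(\<Sum>v\<in>V. c v) = 1"
  shows "runs I 0 V (\<lambda>x. c)"
  unfolding runs_def using assms
  by (intro exI[of _ "\<lambda>v x y. c v"]) (auto intro: psd_kernel_const reach_0)

lemma runs_return:
  assumes "finite V" "v \<in> V"
  shows "runs I 0 V (\<lambda>x w. of_bool (w = v))"
  by (rule runs_random) (use assms in \<open>auto simp: of_bool_def\<close>)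

lemma runs_query:
  assumes "i \<in> I" "finite I"
  shows "runs I 1 UNIV (\<lambda>x b. of_bool (b = (i \<in> x)))"
proof -
  \<comment> \<open>Half of the weight idles and half queries \<open>i\<close>. Afterwards the inner
    product of the states is 1 if the inputs agree on \<open>i\<close> and 0 otherwise, so the bit
    can be read with certainty.\<close>
  have "reach I (Suc 0) (\<lambda>x y. 1/2 + (\<Sum>i'\<in>I. phase i' x * phase i' y * (if i' = i then 1/2 else 0)))"
    using assms reach_0[of I] by (intro reach_Suc) (auto intro: psd_kernel_const)
  also have "(\<lambda>x y. 1/2 + (\<Sum>i'\<in>I. phase i' x * phase i' y * (if i' = i then 1/2 else 0))) =
    (\<lambda>x y. \<Sum>b\<in>UNIV. of_bool (b = (i \<in> x)) * of_bool (b = (i \<in> y)))"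
    using assms by (auto simp: fun_eq_iff UNIV_bool phase_def if_distrib[of "\<lambda>c. _ * c"] cong: if_cong)
  finally show ?thesis
    unfolding runs_def by (intro exI[of _ "\<lambda>b x y. of_bool (b = (i \<in> x)) * of_bool (b = (i \<in> y))"])
      (auto intro: psd_kernel_rank1)
qed

lemma runs_query_all:
  assumes "finite I" "S \<subseteq> I"
  shows "runs I (card S) (Pow S) (\<lambda>x v. of_bool (v = x \<inter> S))"
proof -
  have "finite S" using assms finite_subset by blast
  then show ?thesis using assms(2)
  proof (induction S rule: finite_induct)
    case empty
    then show ?case by (auto intro: runs_cong[OF runs_return[of "{{}}" "{}"]])
  next
    case (insert i S)
    have q: "runs I 1 (Pow (insert i S)) (\<lambda>x w. of_bool (w = v \<union> (x \<inter> {i})))" if "v \<in> Pow S" for v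
    proof -
      have "runs I (1 + 0) (Pow (insert i S)) (\<lambda>x w. \<Sum>b\<in>UNIV. of_bool (b = (i \<in> x)) *
              of_bool (w = (if b then insert i v else v)))"
        using insert.prems insert.hyps assms(1) that
        by (intro runs_bind runs_query runs_return) auto
      then show ?thesis
        by (simp, elim runs_cong) (auto simp: UNIV_bool)
    qed
    have "runs I (card S + 1) (Pow (insert i S)) (\<lambda>x w. \<Sum>v\<in>Pow S. of_bool (v = x \<inter> S) * of_bool (w = v \<union> (x \<inter> {i})))"
      using insert q assms(1) by (intro runs_bind) auto
    then have "runs I (card S + 1) (Pow (insert i S)) (\<lambda>x w. of_bool (w = x \<inter> insert i S))"
    proof (rule runs_cong)
      fix x w
      have "(\<Sum>v\<in>Pow S. of_bool (v = x \<inter> S) * of_bool (w = v \<union> (x \<inter> {i}))) =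
        (\<Sum>v\<in>Pow S. if v = x \<inter> S then of_bool (w = v \<union> (x \<inter> {i})) else (0::real))"
        by (intro sum.cong) auto
      also have "\<dots> = of_bool (w = x \<inter> S \<union> (x \<inter> {i}))"
        using insert.hyps by simp
      also have "x \<inter> S \<union> (x \<inter> {i}) = x \<inter> insert i S" by auto
      finally show "(\<Sum>v\<in>Pow S. of_bool (v = x \<inter> S) * of_bool (w = v \<union> (x \<inter> {i}))) =
        (of_bool (w = x \<inter> insert i S) :: real)" .
    qed
    then show ?case using insert.hyps by simp
  qed
qed

section \<open>Realization of Gram matrices by circuits\<close>

lemma finite_qbasis: "finite I \<Longrightarrow> finite (qbasis I w)"
  by (simp add: qbasis_def)

lemma unitary_on_of_orthogonal:
  assumes "orthogonal_on B U"
  shows "unitary_on B (\<lambda>s t. complex_of_real (U s t))"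
proof -
  have "(\<Sum>r\<in>B. cnj (complex_of_real (U r s)) * complex_of_real (U r t)) =
        complex_of_real (\<Sum>r\<in>B. U r s * U r t)" for s t by simp
  then show ?thesis using assms by (simp only: unitary_on_def orthogonal_on_def) auto
qed

lemma apply_matrix_of_real:
  assumes "\<And>t. t \<in> B \<Longrightarrow> \<psi> t = complex_of_real (u t)"
  shows "apply_matrix B (\<lambda>s t. complex_of_real (U s t)) \<psi> s = complex_of_real (\<Sum>t\<in>B. U s t * u t)"
  using assms by (simp add: apply_matrix_def)

text \<open>\<open>p\<close> and \<open>q\<close> are the coordinates in the basis (|0> + |1>) /
  sqrt 2, (|0> - |1>) / sqrt 2 of the answer bit, in which the query gate is diagonal.\<close>

definition hadamard :: "('i \<Rightarrow> nat \<Rightarrow> real) \<Rightarrow> ('i \<Rightarrow> nat \<Rightarrow> real) \<Rightarrow> 'i qbasis \<Rightarrow> real" where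
  "hadamard p q = (\<lambda>(i, b, z). (p i z + (if b then -1 else 1) * q i z) / sqrt 2)"

lemma gram_inner_hadamard:
  "gram_inner (qbasis I w) (hadamard p q) (hadamard p' q') =
     (\<Sum>i\<in>I. \<Sum>z<w. p i z * p' i z) + (\<Sum>i\<in>I. \<Sum>z<w. q i z * q' i z)"
proof -
  have "gram_inner (qbasis I w) (hadamard p q) (hadamard p' q') =
     (\<Sum>i\<in>I. \<Sum>b\<in>UNIV. \<Sum>z<w. hadamard p q (i, b, z) * hadamard p' q' (i, b, z))"
    by (simp add: gram_inner_def qbasis_def sum.cartesian_product case_prod_unfold)
  also have "\<dots> = (\<Sum>i\<in>I. \<Sum>z<w. p i z * p' i z + q i z * q' i z)"
    by (intro sum.cong refl) (simp add: UNIV_bool hadamard_def flip: sum.distrib, intro sum.cong refl, simp add: field_simps)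
  finally show ?thesis by (simp add: sum.distrib)
qed

lemma query_gate_hadamard:
  "query_gate x (\<lambda>s. complex_of_real (hadamard p q s)) s =
     complex_of_real (hadamard p (\<lambda>i z. phase i x * q i z) s)"
  by (cases s) (auto simp: query_gate_def hadamard_def phase_def)

lemma state_after_cong:
  assumes "work_dim A = work_dim A'" "start_state A = start_state A'"
    and "\<And>l. l \<le> k \<Longrightarrow> unitaries A l = unitaries A' l"
  shows "state_after I A x k = state_after I A' x k"
  using assms(3) by (induction k) (simp_all add: alg_basis_def assms(1,2))

text \<open>Every family \<open>v\<close> with Gram matrix \<open>K\<close> is attained, because the
  last unitary may be any orthogonal map. The induction needs this freedom: before a query, the
  state must have the form \<open>hadamard p q\<close>. It needs all large \<open>w\<close>, since
  one dimension has to serve all steps.\<close>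

lemma reach_realize:
  assumes "reach I T K" "finite I" "i0 \<in> I"
  shows "\<exists>w0. \<forall>w\<ge>w0. \<forall>v. (\<forall>x\<in>Pow I. \<forall>y\<in>Pow I. gram_inner (qbasis I w) (v x) (v y) = K x y) \<longrightarrow>
    (\<exists>A. is_qalg I A \<and> num_queries A = T \<and> work_dim A = w \<and>
      (\<forall>x\<in>Pow I. \<forall>s\<in>qbasis I w. state_after I A x T s = complex_of_real (v x s)))"
  using assms(1)
proof induction
  case reach_0
  have finite_Pow: "finite (Pow I)" using assms by simp
  have "\<exists>A. is_qalg I A \<and> num_queries A = 0 \<and> work_dim A = w \<and>
      (\<forall>x\<in>Pow I. \<forall>s\<in>qbasis I w. state_after I A x 0 s = complex_of_real (v x s))"
    if "w \<ge> 1" and v: "\<forall>x\<in>Pow I. \<forall>y\<in>Pow I. gram_inner (qbasis I w) (v x) (v y) = 1" for w v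
  proof -
    let ?B = "qbasis I w"
    let ?s = "(i0, False, 0)"
    have fin: "finite ?B" using assms by (simp add: finite_qbasis)
    have s: "?s \<in> ?B" using that assms by (simp add: qbasis_def)
    define e :: "'a set \<Rightarrow> 'a qbasis \<Rightarrow> real" where "e x s = (if s = ?s then 1 else 0)" for x s
    have "gram_inner ?B (e x) (e y) = (\<Sum>s\<in>?B. if s = ?s then 1 else 0)" for x y
      unfolding gram_inner_def e_def by (rule sum.cong) auto
    then have gram: "\<forall>x\<in>Pow I. \<forall>y\<in>Pow I. gram_inner ?B (e x) (e y) = gram_inner ?B (v x) (v y)"
      using s fin v by simp
    then obtain U where U: "orthogonal_on ?B U"
      "\<And>x s. x \<in> Pow I \<Longrightarrow> s \<in> ?B \<Longrightarrow> (\<Sum>t\<in>?B. U s t * e x t) = v x s"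
      using orthogonal_map_exists[OF fin finite_Pow gram] by blast
    define A where "A = \<lparr>num_queries = 0, work_dim = w, start_state = ?s,
      unitaries = \<lambda>_ s t. complex_of_real (U s t), result = \<lambda>_. None\<rparr>"
    have B: "alg_basis I A = ?B" by (simp add: alg_basis_def A_def)
    have "is_qalg I A"
      unfolding is_qalg_def B using s U(1) by (simp add: A_def unitary_on_of_orthogonal)
    moreover have "state_after I A x 0 s = complex_of_real (v x s)" if "x \<in> Pow I" "s \<in> ?B" for x s
    proof -
      have "state_after I A x 0 s = apply_matrix ?B (\<lambda>s t. complex_of_real (U s t)) (\<lambda>s. if s = ?s then 1 else 0) s"
        by (simp add: B) (simp add: A_def)
      also have "\<dots> = complex_of_real (\<Sum>t\<in>?B. U s t * e x t)"
        by (rule apply_matrix_of_real) (simp add: e_def)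
      finally show ?thesis using U(2)[OF that] by simp
    qed
    moreover have "num_queries A = 0" "work_dim A = w" by (simp_all add: A_def)
    ultimately show ?thesis by blast
  qed
  then show ?case by blast
next
  case (reach_Suc T A M)
  obtain w1 where w1: "\<And>w v. w \<ge> w1 \<Longrightarrow>
      (\<forall>x\<in>Pow I. \<forall>y\<in>Pow I. gram_inner (qbasis I w) (v x) (v y) = A x y + (\<Sum>i\<in>I. M i x y)) \<Longrightarrow>
      (\<exists>A. is_qalg I A \<and> num_queries A = T \<and> work_dim A = w \<and>
      (\<forall>x\<in>Pow I. \<forall>s\<in>qbasis I w. state_after I A x T s = complex_of_real (v x s)))"
    using reach_Suc.IH by blast
  obtain wA where wA: "\<And>w. w \<ge> wA \<Longrightarrow> \<exists>a. \<forall>x y. A x y = (\<Sum>l<(w::nat). a l x * a l y)"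
    using psd_kernel_pad[OF reach_Suc.hyps(2)] by blast
  have "\<forall>i\<in>I. \<exists>w0. \<forall>w\<ge>w0. \<exists>a. \<forall>x y. M i x y = (\<Sum>l<(w::nat). a l x * a l y)"
    using psd_kernel_pad[OF reach_Suc.hyps(3)] by blast
  from bchoice[OF this] obtain wM where
    wM: "\<And>i w. i \<in> I \<Longrightarrow> w \<ge> wM i \<Longrightarrow> \<exists>a. \<forall>x y. M i x y = (\<Sum>l<(w::nat). a l x * a l y)"
    by blast
  define w0 where "w0 = w1 + wA + (\<Sum>i\<in>I. wM i)"
  have "\<exists>A. is_qalg I A \<and> num_queries A = Suc T \<and> work_dim A = w \<and>
      (\<forall>x\<in>Pow I. \<forall>s\<in>qbasis I w. state_after I A x (Suc T) s = complex_of_real (v x s))"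
    if "w \<ge> w0" and v: "\<forall>x\<in>Pow I. \<forall>y\<in>Pow I. gram_inner (qbasis I w) (v x) (v y) =
         A x y + (\<Sum>i\<in>I. phase i x * phase i y * M i x y)" for w v
  proof -
    let ?B = "qbasis I w"
    have fin: "finite ?B" using assms by (simp add: finite_qbasis)
    have finite_Pow: "finite (Pow I)" using assms by simp
    have "w \<ge> wM i" if "i \<in> I" for i
      using \<open>w \<ge> w0\<close> member_le_sum[OF that, of wM] assms(2) by (simp add: w0_def)
    then have "\<forall>i\<in>I. \<exists>a. \<forall>x y. M i x y = (\<Sum>l<w. a l x * a l y)" using wM by blast
    from bchoice[OF this] obtain m where
      m: "\<And>i x y. i \<in> I \<Longrightarrow> M i x y = (\<Sum>l<w. m i l x * m i l y)" by blast
    obtain a where a: "\<And>x y. A x y = (\<Sum>l<w. a l x * a l y)"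
      using wA[of w] \<open>w \<ge> w0\<close> by (auto simp: w0_def)
    \<comment> \<open>The query register has no idle value, so the idle part sits at index
      \<open>i0\<close>; its answer bit makes it invariant under queries.\<close>
    define p where "p x i z = (if i = i0 then a z x else 0)" for x i z
    define q where "q x i z = m i z x" for x i z
    have pp: "(\<Sum>i\<in>I. \<Sum>z<w. p x i z * p y i z) = A x y" for x y
    proof -
      have "(\<Sum>i\<in>I. \<Sum>z<w. p x i z * p y i z) = (\<Sum>i\<in>I. if i = i0 then A x y else 0)"
        by (intro sum.cong refl) (auto simp: p_def a)
      then show ?thesis using assms(2,3) by simp
    qed
    have "gram_inner ?B (hadamard (p x) (q x)) (hadamard (p y) (q y)) = A x y + (\<Sum>i\<in>I. M i x y)" for x y
      by (simp add: gram_inner_hadamard pp) (simp add: q_def m)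
    then obtain Q where Q: "is_qalg I Q" "num_queries Q = T" "work_dim Q = w"
      "\<And>x s. x \<in> Pow I \<Longrightarrow> s \<in> ?B \<Longrightarrow> state_after I Q x T s = complex_of_real (hadamard (p x) (q x) s)"
      using w1[of w "\<lambda>x. hadamard (p x) (q x)"] \<open>w \<ge> w0\<close> by (auto simp: w0_def)
    define u where "u x = hadamard (p x) (\<lambda>i z. phase i x * q x i z)" for x
    have "gram_inner ?B (u x) (u y) = A x y + (\<Sum>i\<in>I. phase i x * phase i y * M i x y)" for x y
      by (simp add: gram_inner_hadamard u_def pp) (simp add: q_def m sum_distrib_left algebra_simps)
    then have gram: "\<forall>x\<in>Pow I. \<forall>y\<in>Pow I. gram_inner ?B (u x) (u y) = gram_inner ?B (v x) (v y)"
      using v by simp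
    then obtain U where U: "orthogonal_on ?B U"
      "\<And>x s. x \<in> Pow I \<Longrightarrow> s \<in> ?B \<Longrightarrow> (\<Sum>t\<in>?B. U s t * u x t) = v x s"
      using orthogonal_map_exists[OF fin finite_Pow gram] by blast
    define Q' where "Q' = Q\<lparr>num_queries := Suc T,
      unitaries := (unitaries Q)(Suc T := \<lambda>s t. complex_of_real (U s t))\<rparr>"
    have B: "alg_basis I Q' = ?B" "alg_basis I Q = ?B" by (simp_all add: alg_basis_def Q'_def Q)
    have "is_qalg I Q'"
      using Q(1) U(1) unfolding is_qalg_def B
      by (auto simp: Q'_def unitary_on_of_orthogonal Q(2) le_Suc_eq)
    moreover have "state_after I Q' x (Suc T) s = complex_of_real (v x s)" if x: "x \<in> Pow I" "s \<in> ?B" for x s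
    proof -
      have eq: "state_after I Q' x T = state_after I Q x T"
        by (rule state_after_cong) (auto simp: Q'_def)
      have qg: "query_gate x (state_after I Q x T) s = complex_of_real (u x s)" if "s \<in> ?B" for s
      proof -
        obtain i b z where s: "s = (i, b, z)" by (cases s)
        then have "(i, b \<noteq> (i \<in> x), z) \<in> ?B" using that by (auto simp: qbasis_def)
        then have "query_gate x (state_after I Q x T) s =
            query_gate x (\<lambda>s. complex_of_real (hadamard (p x) (q x) s)) s"
          using Q(4)[OF x(1)] by (simp add: query_gate_def s)
        then show ?thesis by (simp add: query_gate_hadamard u_def)
      qed
      have "state_after I Q' x (Suc T) s =
          apply_matrix ?B (\<lambda>s t. complex_of_real (U s t)) (query_gate x (state_after I Q x T)) s"
        by (simp add: B eq) (simp add: Q'_def)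
      also have "\<dots> = complex_of_real (\<Sum>t\<in>?B. U s t * u x t)"
        by (rule apply_matrix_of_real) (rule qg)
      finally show ?thesis using U(2)[OF x] by simp
    qed
    moreover have "num_queries Q' = Suc T" "work_dim Q' = w" by (simp_all add: Q'_def Q)
    ultimately show ?thesis by blast
  qed
  then show ?case by blast
qed

text \<open>The outcome is stored in the workspace register, modulo 3.\<close>

lemma runs_realize:
  assumes "runs I T UNIV p" "finite I" "I \<noteq> {}"
  obtains A where "is_qalg I A" "num_queries A = T"
    and "\<And>x v. x \<subseteq> I \<Longrightarrow> output_prob I A x v = p x v"
proof -
  obtain M where M: "reach I T (\<lambda>x y. \<Sum>v\<in>UNIV. M v x y)" "\<And>v. psd_kernel (M v)" "\<And>v x. M v x x = p x v"
    using assms(1) by (auto simp: runs_def)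
  obtain i0 where i0: "i0 \<in> I" using assms(3) by blast
  obtain w0 where w0: "\<And>w v. w \<ge> w0 \<Longrightarrow> (\<forall>x\<in>Pow I. \<forall>y\<in>Pow I. gram_inner (qbasis I w) (v x) (v y) = (\<Sum>v\<in>UNIV. M v x y)) \<Longrightarrow>
    (\<exists>A. is_qalg I A \<and> num_queries A = T \<and> work_dim A = w \<and>
      (\<forall>x\<in>Pow I. \<forall>s\<in>qbasis I w. state_after I A x T s = complex_of_real (v x s)))"
    using reach_realize[OF M(1) assms(2) i0] by blast
  have "\<forall>v. \<exists>w0. \<forall>w\<ge>w0. \<exists>a. \<forall>x y. M v x y = (\<Sum>l<(w::nat). a l x * a l y)"
    using psd_kernel_pad[OF M(2)] by blast
  then obtain wM where wM: "\<And>v w. w \<ge> wM v \<Longrightarrow> \<exists>a. \<forall>x y. M v x y = (\<Sum>l<(w::nat). a l x * a l y)"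
    by metis
  define w where "w = w0 + wM None + wM (Some True) + wM (Some False)"
  have "w \<ge> wM v" for v
  proof (cases v)
    case (Some b)
    then show ?thesis by (cases b) (auto simp: w_def)
  qed (simp add: w_def)
  then have "\<forall>v. \<exists>a. \<forall>x y. M v x y = (\<Sum>l<w. a l x * a l y)" using wM by blast
  then obtain m where m: "\<And>v x y. M v x y = (\<Sum>l<w. m v l x * m v l y)" by metis
  define code :: "bool option \<Rightarrow> nat" where
    "code v = (case v of None \<Rightarrow> 0 | Some False \<Rightarrow> 1 | Some True \<Rightarrow> 2)" for v
  define out where "out z = (if z mod 3 = 0 then None else Some (z mod 3 = 2))" for z :: nat
  have code: "code v < 3" "out (3 * l + code v) = v" for v l
  proof -
    consider "v = None" | "v = Some True" | "v = Some False" by (metis (full_types) not_Some_eq)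
    note v_cases = this
    show "code v < 3" using v_cases by cases (simp_all add: code_def)
    show "out (3 * l + code v) = v"
      using v_cases by cases (simp_all add: code_def out_def mod_simps, presburger+)
  qed
  have code_out: "code (out z) = z mod 3" for z
  proof -
    consider "z mod 3 = 0" | "z mod 3 = 1" | "z mod 3 = 2" by linarith
    then show ?thesis by cases (simp_all add: code_def out_def)
  qed
  define u where "u x = (\<lambda>(i, b, z). if i = i0 \<and> \<not> b then m (out z) (z div 3) x else 0)" for x
  have bij: "bij_betw (\<lambda>(v, l). (i0, False, 3 * l + code v)) (V \<times> {..<w})
      {s \<in> qbasis I (3 * w). fst s = i0 \<and> \<not> fst (snd s) \<and> out (snd (snd s)) \<in> V}" for V
  proof (rule bij_betwI[where g = "\<lambda>s. (out (snd (snd s)), snd (snd s) div 3)"])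
    show "(\<lambda>(v, l). (i0, False, 3 * l + code v)) \<in> V \<times> {..<w} \<rightarrow>
       {s \<in> qbasis I (3 * w). fst s = i0 \<and> \<not> fst (snd s) \<and> out (snd (snd s)) \<in> V}"
    proof (clarsimp simp: qbasis_def i0 code(2))
      fix v l assume "l < w"
      then show "3 * l + code v < 3 * w" using code(1)[of v] by linarith
    qed
    show "(\<lambda>s. (out (snd (snd s)), snd (snd s) div 3)) \<in>
       {s \<in> qbasis I (3 * w). fst s = i0 \<and> \<not> fst (snd s) \<and> out (snd (snd s)) \<in> V} \<rightarrow> V \<times> {..<w}"
      by (auto simp: qbasis_def)
  qed (use code in \<open>auto simp: code_out\<close>)
  have sum_out: "(\<Sum>s | s \<in> qbasis I (3 * w) \<and> out (snd (snd s)) \<in> V. u x s * u y s) = (\<Sum>v\<in>V. M v x y)" for V x y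
  proof -
    have "(\<Sum>s | s \<in> qbasis I (3 * w) \<and> out (snd (snd s)) \<in> V. u x s * u y s) =
      (\<Sum>s\<in>{s \<in> qbasis I (3 * w). fst s = i0 \<and> \<not> fst (snd s) \<and> out (snd (snd s)) \<in> V}. u x s * u y s)"
      using finite_qbasis[OF assms(2)] by (intro sum.mono_neutral_right) (auto simp: u_def split: if_splits)
    also have "\<dots> = (\<Sum>(v, l)\<in>V \<times> {..<w}. m v l x * m v l y)"
      by (subst sum.reindex_bij_betw[OF bij, symmetric], rule sum.cong)
        (use code in \<open>auto simp: u_def\<close>)
    also have "\<dots> = (\<Sum>v\<in>V. M v x y)"
      by (simp add: m sum.cartesian_product)
    finally show ?thesis .
  qed
  have "\<forall>x\<in>Pow I. \<forall>y\<in>Pow I. gram_inner (qbasis I (3 * w)) (u x) (u y) = (\<Sum>v\<in>UNIV. M v x y)"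
    using sum_out[where V = UNIV] by (simp add: gram_inner_def)
  then obtain A where A: "is_qalg I A" "num_queries A = T" "work_dim A = 3 * w"
      "\<And>x s. x \<in> Pow I \<Longrightarrow> s \<in> qbasis I (3 * w) \<Longrightarrow> state_after I A x T s = complex_of_real (u x s)"
    using w0[of "3 * w" u] by (auto simp: w_def)
  define A' where "A' = A\<lparr>result := \<lambda>s. out (snd (snd s))\<rparr>"
  have A'_sel: "result A' = (\<lambda>s. out (snd (snd s)))" "num_queries A' = T" by (simp_all add: A'_def A)
  have B: "alg_basis I A' = qbasis I (3 * w)" by (simp add: A'_def alg_basis_def A)
  have st: "state_after I A' x k = state_after I A x k" for x k
    by (rule state_after_cong) (simp_all add: A'_def)
  have "output_prob I A' x v = p x v" if "x \<subseteq> I" for x v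
  proof -
    have "output_prob I A' x v = (\<Sum>s | s \<in> qbasis I (3 * w) \<and> out (snd (snd s)) \<in> {v}. u x s * u x s)"
      unfolding output_prob_def B using A(4)[of x] that
      by (intro sum.cong) (auto simp: st A'_sel power2_eq_square)
    then show ?thesis by (simp only: sum_out) (simp add: M(3))
  qed
  moreover have "is_qalg I A'" using A(1) by (simp add: is_qalg_def A'_def alg_basis_def)
  moreover note A'_sel(2)
  ultimately show thesis using that by blast
qed

lemma Q0_le:
  assumes "runs I T UNIV p" "finite I" "I \<noteq> {}"
    and "\<And>x. x \<subseteq> I \<Longrightarrow> p x (Some (\<not> f x)) = 0" "\<And>x. x \<subseteq> I \<Longrightarrow> p x None \<le> 1 / 2"
  shows "Q0 I f \<le> T"
    and "\<exists>A. is_qalg I A \<and> num_queries A = Q0 I f \<and> zero_error_computes I A f"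
proof -
  obtain A where A: "is_qalg I A" "num_queries A = T" "\<And>x v. x \<subseteq> I \<Longrightarrow> output_prob I A x v = p x v"
    using runs_realize[OF assms(1-3)] by blast
  then have *: "\<exists>A. is_qalg I A \<and> num_queries A = T \<and> zero_error_computes I A f"
    using assms(4,5) by (auto simp: zero_error_computes_def)
  show "Q0 I f \<le> T" unfolding Q0_def by (rule Least_le) (rule *)
  show "\<exists>A. is_qalg I A \<and> num_queries A = Q0 I f \<and> zero_error_computes I A f"
    unfolding Q0_def by (rule LeastI) (rule *)
qed

text \<open>This carries a lower bound for all algorithms over to the \<open>LEAST\<close> in
  \<open>Q0\<close>.\<close>

lemma Q0_attained:
  assumes "finite I" "I \<noteq> {}"
  shows "\<exists>A. is_qalg I A \<and> num_queries A = Q0 I f \<and> zero_error_computes I A f"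
proof (rule Q0_le(2))
  show "runs I (card I + 0) UNIV (\<lambda>x w. \<Sum>v\<in>Pow I. of_bool (v = x \<inter> I) * of_bool (w = Some (f v)))"
    using assms by (intro runs_bind runs_query_all runs_return) auto
  have *: "(\<Sum>v\<in>Pow I. of_bool (v = x \<inter> I) * of_bool (w = Some (f v))) = (of_bool (w = Some (f x)) :: real)"
    if "x \<subseteq> I" for x w
  proof -
    have "(\<Sum>v\<in>Pow I. of_bool (v = x \<inter> I) * of_bool (w = Some (f v))) =
          (\<Sum>v\<in>Pow I. if v = x then of_bool (w = Some (f v)) else (0 :: real))"
      using that by (intro sum.cong refl) (auto simp: Int_absorb2)
    then show ?thesis using that assms by simp
  qed
  show "(\<Sum>v\<in>Pow I. of_bool (v = x \<inter> I) * of_bool (Some (\<not> f x) = Some (f v))) = (0 :: real)" if "x \<subseteq> I" for x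
    by (subst *[OF that]) simp
  show "(\<Sum>v\<in>Pow I. of_bool (v = x \<inter> I) * of_bool (None = Some (f v))) \<le> (1 / 2 :: real)" if "x \<subseteq> I" for x
    by simp
qed (use assms in auto)

section \<open>Quantum search with an unknown number of solutions\<close>

lemma reach_diag:
  assumes "reach I T K" shows "K x x = 1"
  using assms
proof induction
  case (reach_Suc T A M)
  then show ?case by (simp add: phase_def if_distrib[of "\<lambda>c. c * c * _"] cong: if_cong)
qed simp

lemma runs_prob:
  assumes "runs I T V p"
  shows "v \<in> V \<Longrightarrow> 0 \<le> p x v" and "(\<Sum>v\<in>V. p x v) = 1"
proof -
  obtain M where M: "reach I T (\<lambda>x y. \<Sum>v\<in>V. M v x y)" "\<And>v. v \<in> V \<Longrightarrow> psd_kernel (M v)"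
    "\<And>v x. v \<in> V \<Longrightarrow> M v x x = p x v"
    using assms by (auto simp: runs_def)
  have "(\<Sum>v\<in>V. p x v) = (\<Sum>v\<in>V. M v x x)" using M(3) by simp
  also have "\<dots> = 1" using reach_diag[OF M(1)] .
  finally show "(\<Sum>v\<in>V. p x v) = 1" .
  assume v: "v \<in> V"
  then obtain w a where "\<And>x y. M v x y = (\<Sum>l<(w::nat). a l x * a l y)"
    using M(2)[OF v] unfolding psd_kernel_def by blast
  then have "M v x x \<ge> 0" by (simp add: sum_nonneg)
  then show "0 \<le> p x v" using M(3)[OF v] by simp
qed

text \<open>The phase query flips the sign of the ones instead of the zeros; this is the usual Grover
  iteration up to a global sign.\<close>

primrec grover :: "'i set \<Rightarrow> 'i set \<Rightarrow> nat \<Rightarrow> 'i \<Rightarrow> real" where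
  "grover J x 0 j = 1 / sqrt (card J)"
| "grover J x (Suc k) j =
     2 / card J * (\<Sum>l\<in>J. phase l x * grover J x k l) - phase j x * grover J x k j"

text \<open>Twice the mean minus the vector is a reflection about the uniform vector. As an
  isometry, the diffusion step of Grover search does not change the Gram matrix and is invisible in
  \<open>reach\<close>.\<close>

lemma sum_diffusion:
  fixes a b :: "'i \<Rightarrow> real"
  assumes "finite J" "J \<noteq> {}"
  shows "(\<Sum>j\<in>J. (2 / card J * (\<Sum>l\<in>J. a l) - a j) * (2 / card J * (\<Sum>l\<in>J. b l) - b j)) = (\<Sum>j\<in>J. a j * b j)"
proof -
  define N A B where "N = real (card J)" and "A = (\<Sum>l\<in>J. a l)" and "B = (\<Sum>l\<in>J. b l)"
  have N: "N > 0" using assms by (simp add: N_def card_gt_0_iff)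
  define c where "c = 4 / N\<^sup>2 * A * B"
  have "(\<Sum>j\<in>J. (2 / N * A - a j) * (2 / N * B - b j)) =
      (\<Sum>j\<in>J. c - 2 / N * A * b j - 2 / N * B * a j + a j * b j)"
    by (intro sum.cong refl) (simp add: c_def algebra_simps power2_eq_square)
  also have "\<dots> = N * c - 2 / N * A * B - 2 / N * B * A + (\<Sum>j\<in>J. a j * b j)"
    by (simp only: sum.distrib sum_subtractf sum_distrib_left[symmetric] sum_constant A_def B_def N_def)
  also have "\<dots> = (\<Sum>j\<in>J. a j * b j)" using N by (simp add: c_def power2_eq_square field_simps)
  finally show ?thesis by (simp add: N_def A_def B_def)
qed

lemma reach_grover:
  assumes "finite I" "J \<subseteq> I" "J \<noteq> {}"
  shows "reach I k (\<lambda>x y. \<Sum>j\<in>J. grover J x k j * grover J y k j)"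
proof (induction k)
  have fin: "finite J" using assms finite_subset by blast
  {
    case 0
    show ?case using reach_0[of I] fin assms(3) by simp
  next
    case (Suc k)
    have restrict: "(\<Sum>i\<in>I. if i \<in> J then g i else 0) = (\<Sum>i\<in>J. g i)" for g :: "'a \<Rightarrow> real"
      using assms by (simp add: sum.inter_restrict[symmetric] Int_absorb1)
    have "reach I (Suc k) (\<lambda>x y. 0 + (\<Sum>i\<in>I. phase i x * phase i y *
             (if i \<in> J then grover J x k i * grover J y k i else 0)))"
    proof (rule reach_Suc)
      show "reach I k (\<lambda>x y. 0 + (\<Sum>i\<in>I. if i \<in> J then grover J x k i * grover J y k i else 0))"
        using Suc by (simp add: restrict)
      show "psd_kernel (\<lambda>x y. if i \<in> J then grover J x k i * grover J y k i else 0)" for i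
        by (cases "i \<in> J") (auto intro: psd_kernel_const psd_kernel_rank1)
    qed (simp add: psd_kernel_const)
    also have "(\<lambda>x y. 0 + (\<Sum>i\<in>I. phase i x * phase i y *
             (if i \<in> J then grover J x k i * grover J y k i else 0))) =
        (\<lambda>x y. \<Sum>j\<in>J. (phase j x * grover J x k j) * (phase j y * grover J y k j))"
      by (simp add: if_distrib[of "\<lambda>c. _ * c"] restrict mult_ac cong: if_cong)
    also have "\<dots> = (\<lambda>x y. \<Sum>j\<in>J. grover J x (Suc k) j * grover J y (Suc k) j)"
      by (simp only: grover.simps sum_diffusion[OF fin assms(3)])
    finally show ?case .
  }
qed

lemma runs_grover:
  assumes "finite I" "J \<subseteq> I" "J \<noteq> {}"
  shows "runs I k J (\<lambda>x j. (grover J x k j)\<^sup>2)"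
  unfolding runs_def using reach_grover[OF assms]
  by (intro exI[of _ "\<lambda>j x y. grover J x k j * grover J y k j"]) (auto intro: psd_kernel_rank1 simp: power2_eq_square)

text \<open>\<open>sqrt (card J) * sin \<theta> * a\<close> and
  \<open>sqrt (card J) * cos \<theta> * b\<close> are the coordinates along the normalized uniform
  vectors on the zeros and on the ones; an iteration rotates them by \<open>2 * \<theta>\<close> and
  flips the sign. Multiplying by \<open>sin \<theta>\<close> and \<open>cos \<theta>\<close> instead
  of dividing covers the cases without zeros or without ones.\<close>

lemma grover_amplitudes:
  assumes "finite J" "J \<noteq> {}"
    and s: "(sin \<theta>)\<^sup>2 = real (card (J - x)) / card J" "(cos \<theta>)\<^sup>2 = real (card (J \<inter> x)) / card J"
    and pos: "sin \<theta> \<ge> 0" "cos \<theta> \<ge> 0"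
  shows "\<exists>a b. (\<forall>j\<in>J. grover J x k j = (if j \<in> x then b else a)) \<and>
     sqrt (card J) * sin \<theta> * a = (-1) ^ k * sin (real (2 * k + 1) * \<theta>) \<and>
     sqrt (card J) * cos \<theta> * b = (-1) ^ k * cos (real (2 * k + 1) * \<theta>)"
proof (induction k)
  case 0
  have "sqrt (card J) \<noteq> 0" using assms(1,2) by simp
  then show ?case by (intro exI[of _ "1 / sqrt (card J)"]) simp
next
  case (Suc k)
  define N where "N = real (card J)"
  have N: "N > 0" using assms(1,2) by (simp add: N_def card_gt_0_iff)
  from Suc obtain a b where ab: "\<And>j. j \<in> J \<Longrightarrow> grover J x k j = (if j \<in> x then b else a)"
    and a: "sqrt N * sin \<theta> * a = (-1) ^ k * sin (real (2 * k + 1) * \<theta>)"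
    and b: "sqrt N * cos \<theta> * b = (-1) ^ k * cos (real (2 * k + 1) * \<theta>)"
    by (auto simp: N_def)
  define m where "m = (sin \<theta>)\<^sup>2 * a - (cos \<theta>)\<^sup>2 * b"
  have "(\<Sum>l\<in>J. phase l x * grover J x k l) = (\<Sum>l\<in>J - x. a) + (\<Sum>l\<in>J \<inter> x. - b)"
  proof -
    have "(\<Sum>l\<in>J. phase l x * grover J x k l) = (\<Sum>l\<in>J. if l \<in> x then - b else a)"
      by (intro sum.cong refl) (simp add: ab phase_def)
    also have "\<dots> = (\<Sum>l\<in>J \<inter> {l. l \<in> x}. - b) + (\<Sum>l\<in>J \<inter> - {l. l \<in> x}. a)"
      by (rule sum.If_cases) (rule assms(1))
    finally show ?thesis by (simp add: Diff_eq)
  qed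
  also have "\<dots> = N * m"
    using N by (simp add: m_def s field_simps flip: N_def)
  finally have mean: "2 / card J * (\<Sum>l\<in>J. phase l x * grover J x k l) = 2 * m"
    using N by (simp flip: N_def)
  have "grover J x (Suc k) j = (if j \<in> x then 2 * m + b else 2 * m - a)" if "j \<in> J" for j
    by (simp only: grover.simps mean) (simp add: ab that phase_def)
  then have "\<forall>j\<in>J. grover J x (Suc k) j = (if j \<in> x then 2 * m + b else 2 * m - a)" by blast
  moreover have angle: "real (2 * Suc k + 1) * \<theta> = real (2 * k + 1) * \<theta> + 2 * \<theta>"
    by (simp add: algebra_simps)
  define S C where "S = sqrt N * sin \<theta> * a" and "C = sqrt N * cos \<theta> * b"
  have SC: "S = (-1) ^ k * sin (real (2 * k + 1) * \<theta>)" "C = (-1) ^ k * cos (real (2 * k + 1) * \<theta>)"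
    by (simp_all only: S_def C_def a b)
  have "sqrt N * sin \<theta> * (2 * m - a) = - (cos (2 * \<theta>) * S + sin (2 * \<theta>) * C)"
    unfolding cos_double_sin sin_double m_def S_def C_def by (simp add: algebra_simps power2_eq_square)
  then have "sqrt (card J) * sin \<theta> * (2 * m - a) = (-1) ^ Suc k * sin (real (2 * Suc k + 1) * \<theta>)"
    unfolding angle sin_add SC N_def by (simp add: algebra_simps)
  moreover have "sqrt N * cos \<theta> * (2 * m + b) = sin (2 * \<theta>) * S - cos (2 * \<theta>) * C"
    unfolding cos_double_cos sin_double m_def S_def C_def by (simp add: algebra_simps power2_eq_square)
  then have "sqrt (card J) * cos \<theta> * (2 * m + b) = (-1) ^ Suc k * cos (real (2 * Suc k + 1) * \<theta>)"
    unfolding angle cos_add SC N_def by (simp add: algebra_simps)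
  ultimately show ?case by blast
qed

text \<open>The square of the sine averages to 1/2 up to a sum of cosines. Multiplied by
  \<open>sin (2 * \<theta>)\<close>, that sum telescopes to
  \<open>sin (4 * real m * \<theta>)\<close>, so it is at most
  \<open>1 / sin (2 * \<theta>)\<close>, hence at most \<open>m\<close>.\<close>

lemma sum_sin_squared_ge:
  assumes "m > 0" "sin (2 * \<theta>) \<ge> 1 / real m"
  shows "(\<Sum>k<m. (sin (real (2 * k + 1) * \<theta>))\<^sup>2) \<ge> real m / 4"
proof -
  define D where "D M = (\<Sum>k<M. 2 * cos (2 * (real (2 * k + 1) * \<theta>)))" for M
  have "sin (2 * \<theta>) * D M = sin (4 * real M * \<theta>)" for M
  proof (induction M)
    case (Suc M)
    define u where "u = 2 * (real (2 * M + 1) * \<theta>)"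
    have "sin (u + 2 * \<theta>) - sin (u - 2 * \<theta>) = 2 * cos u * sin (2 * \<theta>)"
      by (simp add: sin_add sin_diff)
    moreover have "u + 2 * \<theta> = 4 * real (Suc M) * \<theta>" "u - 2 * \<theta> = 4 * real M * \<theta>"
      by (simp_all add: u_def algebra_simps)
    ultimately show ?case using Suc by (simp add: D_def algebra_simps flip: u_def)
  qed (simp add: D_def)
  then have "sin (2 * \<theta>) * D m \<le> 1" by simp
  have "D m \<le> m"
  proof (rule ccontr)
    assume "\<not> D m \<le> m"
    then have "real m * (1 / real m) < D m * sin (2 * \<theta>)"
      using assms by (intro mult_less_le_imp_less) auto
    then show False using \<open>sin (2 * \<theta>) * D m \<le> 1\<close> assms(1) by (simp add: mult.commute)
  qed
  have "(sin y)\<^sup>2 = 1 / 2 - 1 / 4 * (2 * cos (2 * y))" for y :: real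
    using cos_double_sin[of y] by linarith
  then have "(\<Sum>k<m. (sin (real (2 * k + 1) * \<theta>))\<^sup>2) = (\<Sum>k<m. 1 / 2 - 1 / 4 * (2 * cos (2 * (real (2 * k + 1) * \<theta>))))"
    by (intro sum.cong refl)
  also have "\<dots> = real m / 2 - 1 / 4 * D m"
    by (simp only: sum_subtractf sum_distrib_left[symmetric] D_def) simp
  finally show ?thesis using \<open>D m \<le> m\<close> by simp
qed

text \<open>The number of iterations is chosen at random, since the number of zeros is unknown. If more
  than \<open>3/4\<close> of the bits are zeros, no iteration at all is a good choice.\<close>

lemma grover_success:
  assumes "finite J" "\<not> J \<subseteq> x" "m > 0" "sqrt (card J) \<le> real m"
  shows "(\<Sum>k<2 * m. 1 / real (2 * m) * (\<Sum>j\<in>J - x. (grover J x (if k < m then k else 0) j)\<^sup>2)) \<ge> 1 / 8"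
proof -
  define N t where "N = card J" and "t = card (J - x)"
  have J: "J \<noteq> {}" using assms(2) by blast
  have N: "N > 0" using J assms(1) by (simp add: N_def card_gt_0_iff)
  have t: "t > 0" using assms(1,2) by (auto simp: t_def card_gt_0_iff)
  have Nt: "N = t + card (J \<inter> x)"
    unfolding N_def t_def using assms(1) by (metis Int_Diff_Un Int_Diff_disjoint add.commute card_Un_disjoint finite_Diff finite_Int)
  have "(sqrt (t / N))\<^sup>2 + (sqrt (card (J \<inter> x) / N))\<^sup>2 = 1"
  proof -
    have "real N = real t + real (card (J \<inter> x))" using Nt by simp
    then show ?thesis using N by (simp flip: add_divide_distrib)
  qed
  then obtain \<theta> where \<theta>: "sqrt (card (J \<inter> x) / N) = cos \<theta>" "sqrt (t / N) = sin \<theta>"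
    using sincos_total_2pi[of "sqrt (card (J \<inter> x) / N)" "sqrt (t / N)"] by (metis add.commute)
  have sq: "(sin \<theta>)\<^sup>2 = real (card (J - x)) / card J" "(cos \<theta>)\<^sup>2 = real (card (J \<inter> x)) / card J"
    by (simp_all add: N_def t_def flip: \<theta>)
  have pos: "sin \<theta> \<ge> 0" "cos \<theta> \<ge> 0" by (simp_all flip: \<theta>)
  have success: "(\<Sum>j\<in>J - x. (grover J x k j)\<^sup>2) = (sin (real (2 * k + 1) * \<theta>))\<^sup>2" for k
  proof -
    obtain a b where ab: "\<forall>j\<in>J. grover J x k j = (if j \<in> x then b else a)"
      "sqrt (card J) * sin \<theta> * a = (-1) ^ k * sin (real (2 * k + 1) * \<theta>)"
      using grover_amplitudes[OF assms(1) J sq pos, of k] by blast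
    have "(\<Sum>j\<in>J - x. (grover J x k j)\<^sup>2) = real t * a\<^sup>2"
      using ab(1) by (simp add: t_def)
    also have "\<dots> = (sqrt (card J) * sin \<theta> * a)\<^sup>2"
      using N by (simp add: power_mult_distrib sq flip: t_def N_def)
    also have "\<dots> = (sin (real (2 * k + 1) * \<theta>))\<^sup>2"
      unfolding ab(2) by (simp add: power_mult_distrib flip: power_mult)
    finally show ?thesis .
  qed
  define F where "F k = (\<Sum>j\<in>J - x. (grover J x k j)\<^sup>2)" for k
  have F: "F k \<ge> 0" for k by (simp add: F_def sum_nonneg)
  have "(\<Sum>k<2 * m. F (if k < m then k else 0)) = (\<Sum>k<m. F k) + (\<Sum>k\<in>{m..<2 * m}. F 0)"
  proof -
    have "(\<Sum>k<2 * m. F (if k < m then k else 0)) =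
      (\<Sum>k<m. F (if k < m then k else 0)) + (\<Sum>k\<in>{m..<2 * m}. F (if k < m then k else 0))"
      by (subst sum.union_disjoint[symmetric]) (auto intro!: sum.cong)
    then show ?thesis by simp
  qed
  also have "\<dots> = (\<Sum>k<m. F k) + real m * F 0" by simp
  also have "\<dots> \<ge> real m / 4"
  \<comment> \<open>\<open>F 0\<close> is the fraction of zeros. Below 1/4 the cosine is at least
    1/2, so \<open>sin (2 * \<theta>) \<ge> sin \<theta>\<close>, which is at least
    \<open>1 / real m\<close> as there is a zero. In either case one half of the
    \<open>2 * m\<close> choices succeeds with average probability at least 1/4.\<close>
  proof (cases "(sin \<theta>)\<^sup>2 \<ge> 1 / 4")
    case True
    then have "F 0 \<ge> 1 / 4" using success[of 0] by (simp add: F_def del: grover.simps)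
    then have "real m * F 0 \<ge> real m * (1 / 4)" by (intro mult_left_mono) auto
    moreover have "(\<Sum>k<m. F k) \<ge> 0" using F by (simp add: sum_nonneg)
    ultimately show ?thesis by simp
  next
    case False
    then have "(cos \<theta>)\<^sup>2 \<ge> (1 / 2)\<^sup>2" using sin_cos_squared_add[of \<theta>] by (simp add: power2_eq_square)
    then have "cos \<theta> \<ge> 1 / 2" using pos(2) by (rule power2_le_imp_le)
    then have "sin \<theta> * 1 \<le> sin \<theta> * (2 * cos \<theta>)" using pos(1) by (intro mult_left_mono) auto
    moreover have "1 / real m \<le> sin \<theta>"
    proof -
      have "1 / real m \<le> 1 / sqrt N" using assms(4) N by (simp add: N_def frac_le)
      also have "\<dots> \<le> sqrt (t / N)" using t N by (simp add: real_sqrt_divide divide_right_mono)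
      finally show ?thesis by (simp add: \<theta>)
    qed
    ultimately have "sin (2 * \<theta>) \<ge> 1 / real m" by (simp add: sin_double)
    then have "(\<Sum>k<m. F k) \<ge> real m / 4"
      using sum_sin_squared_ge[OF assms(3)] by (simp add: F_def success)
    moreover have "real m * F 0 \<ge> 0" using F by simp
    ultimately show ?thesis by linarith
  qed
  finally have "1 / real (2 * m) * (real m / 4) \<le> 1 / real (2 * m) * (\<Sum>k<2 * m. F (if k < m then k else 0))"
    by (intro mult_left_mono) auto
  then show ?thesis using assms(3) by (simp add: F_def sum_distrib_left)
qed

text \<open>The index that is found is checked by one more query, which makes the error one-sided.
  Runs with fewer than \<open>m\<close> iterations idle.\<close>

lemma runs_search:
  assumes "finite I" "J \<subseteq> I" "J \<noteq> {}" "m > 0" "sqrt (card J) \<le> real m"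
  shows "\<exists>p. runs I (m + 1) (UNIV :: bool set) p \<and>
    (\<forall>x. (J \<subseteq> x \<longrightarrow> p x True = 0) \<and> (\<not> J \<subseteq> x \<longrightarrow> p x True \<ge> 1 / 8))"
proof -
  have fin: "finite J" using assms finite_subset by blast
  define q where "q x j = (\<Sum>k<2 * m. 1 / real (2 * m) * (grover J x (if k < m then k else 0) j)\<^sup>2)" for x j
  have "runs I (0 + m) J q"
    unfolding q_def using assms(1,4) fin
    by (intro runs_bind runs_random runs_idle[OF runs_grover[OF assms(1-3)]]) auto
  moreover have "runs I (1 + 0) UNIV (\<lambda>x b. \<Sum>a\<in>UNIV. of_bool (a = (j \<in> x)) * of_bool (b = (\<not> a)))" if "j \<in> J" for j
    using assms(1,2) that by (intro runs_bind runs_query runs_return) auto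
  ultimately have "runs I (m + 1) UNIV (\<lambda>x b. \<Sum>j\<in>J. q x j * (\<Sum>a\<in>UNIV. of_bool (a = (j \<in> x)) * of_bool (b = (\<not> a))))"
    using assms(1) fin by (intro runs_bind) auto
  then have "runs I (m + 1) UNIV (\<lambda>x b. \<Sum>j\<in>J. q x j * of_bool (b = (j \<notin> x)))"
    by (rule runs_cong) (auto simp: UNIV_bool intro!: sum.cong)
  moreover have "(\<Sum>j\<in>J. q x j * of_bool (True = (j \<notin> x))) = (\<Sum>j\<in>J - x. q x j)" for x
    using fin by (intro sum.mono_neutral_cong_right) auto
  moreover have "(\<Sum>j\<in>J - x. q x j) \<ge> 1 / 8" if "\<not> J \<subseteq> x" for x
    using grover_success[OF fin that assms(4,5)]
    unfolding q_def by (subst sum.swap) (simp add: sum_distrib_left)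
  moreover have "(\<Sum>j\<in>J - x. q x j) = 0" if "J \<subseteq> x" for x
    using that by (intro sum.neutral) auto
  ultimately show ?thesis
    by (intro exI[of _ "\<lambda>x b. \<Sum>j\<in>J. q x j * of_bool (b = (j \<notin> x))"]) auto
qed

section \<open>Random walk through the rows\<close>

text \<open>The distribution of the row being searched after \<open>k\<close> searches, where \<open>s i\<close> is the probability that a
  search finds a missing edge in row \<open>i\<close>; \<open>n\<close> stands for being done with all rows.\<close>

primrec walk :: "nat \<Rightarrow> (nat \<Rightarrow> real) \<Rightarrow> nat \<Rightarrow> nat \<Rightarrow> real" where
  "walk n s 0 i = of_bool (i = 0)"
| "walk n s (Suc k) i = (\<Sum>l\<le>n. walk n s k l *
     (if l < n then s l * of_bool (i = Suc l) + (1 - s l) * of_bool (i = l) else of_bool (i = l)))"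

lemma walk_nonneg:
  assumes "\<And>i. i < n \<Longrightarrow> 0 \<le> s i \<and> s i \<le> 1"
  shows "walk n s k i \<ge> 0"
  using assms by (induction k arbitrary: i) (auto intro!: sum_nonneg mult_nonneg_nonneg)

text \<open>Supermartingale argument for a time-dependent potential; the state \<open>n\<close> is
  absorbing.\<close>

lemma walk_expectation_le:
  assumes "\<And>i. i < n \<Longrightarrow> 0 \<le> s i \<and> s i \<le> 1"
    and "\<And>k i. i < n \<Longrightarrow> s i * \<Phi> (Suc k) (Suc i) + (1 - s i) * \<Phi> (Suc k) i \<le> \<Phi> k i"
    and "\<And>k. \<Phi> (Suc k) n \<le> \<Phi> k n"
  shows "(\<Sum>i\<le>n. walk n s k i * \<Phi> k i) \<le> \<Phi> 0 0"
proof (induction k)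
  case 0
  have "(\<Sum>i\<le>n. walk n s 0 i * \<Phi> 0 i) = (\<Sum>i\<le>n. if i = 0 then \<Phi> 0 0 else 0)"
    by (intro sum.cong) auto
  then show ?case by simp
next
  case (Suc k)
  define st where "st l i = (if l < n then s l * of_bool (i = Suc l) + (1 - s l) * of_bool (i = l) else of_bool (i = l))" for l i :: nat
  have "(\<Sum>i\<le>n. walk n s (Suc k) i * \<Phi> (Suc k) i) = (\<Sum>l\<le>n. walk n s k l * (\<Sum>i\<le>n. st l i * \<Phi> (Suc k) i))"
    by (simp add: sum_distrib_left sum_distrib_right mult.assoc flip: st_def) (rule sum.swap)
  also have "\<dots> \<le> (\<Sum>l\<le>n. walk n s k l * \<Phi> k l)"
  proof (intro sum_mono mult_left_mono walk_nonneg assms(1))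
    fix l assume "l \<in> {..n}"
    show "(\<Sum>i\<le>n. st l i * \<Phi> (Suc k) i) \<le> \<Phi> k l"
    proof (cases "l < n")
      case True
      have "(\<Sum>i\<le>n. st l i * \<Phi> (Suc k) i) =
          (\<Sum>i\<le>n. (if i = Suc l then s l * \<Phi> (Suc k) (Suc l) else 0) + (if i = l then (1 - s l) * \<Phi> (Suc k) l else 0))"
        using True by (intro sum.cong) (auto simp: st_def)
      also have "\<dots> = s l * \<Phi> (Suc k) (Suc l) + (1 - s l) * \<Phi> (Suc k) l"
        using True by (simp add: sum.distrib)
      finally show ?thesis using assms(2)[OF True, of k] by simp
    next
      case False
      then have l: "l = n" using \<open>l \<in> {..n}\<close> by simp
      have "(\<Sum>i\<le>n. st l i * \<Phi> (Suc k) i) = (\<Sum>i\<le>n. if i = n then \<Phi> (Suc k) n else 0)"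
        by (intro sum.cong) (auto simp: st_def l)
      then show ?thesis using assms(3)[of k] by (simp add: l)
    qed
  qed auto
  finally show ?case using Suc by simp
qed

text \<open>\<open>r\<close> is meant as the first full row, or \<open>n\<close> if there is none.
  The walk starts at or before this barrier, advances one row at a time and cannot leave it.\<close>

lemma walk_beyond_eq_0:
  assumes "\<And>i. i < n \<Longrightarrow> 0 \<le> s i \<and> s i \<le> 1" "r < n \<Longrightarrow> s r = 0" "r < i" "i \<le> n"
  shows "walk n s k i = 0"
proof -
  let ?\<Phi> = "\<lambda>k i. of_bool (r < i) :: real"
  have "(\<Sum>i\<le>n. walk n s k i * ?\<Phi> k i) \<le> ?\<Phi> 0 0"
  proof (rule walk_expectation_le[where \<Phi> = ?\<Phi>])
    fix i assume "i < n"
    then show "s i * of_bool (r < Suc i) + (1 - s i) * of_bool (r < i) \<le> of_bool (r < i)"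
      using assms(2) by (cases "i = r") auto
  qed (use assms in auto)
  moreover have "walk n s k i * ?\<Phi> k i \<le> (\<Sum>i\<le>n. walk n s k i * ?\<Phi> k i)"
    using assms(4) by (intro member_le_sum) (auto intro: mult_nonneg_nonneg walk_nonneg[OF assms(1)])
  ultimately have "walk n s k i \<le> 0" using assms(3) by simp
  moreover have "walk n s k i \<ge> 0" by (rule walk_nonneg[OF assms(1)])
  ultimately show ?thesis by simp
qed

text \<open>The expectation of \<open>(r - i) + k / 8\<close>, restricted to the walks that have not reached \<open>r\<close>, does not increase.\<close>

lemma walk_before_le:
  assumes "\<And>i. i < n \<Longrightarrow> 0 \<le> s i \<and> s i \<le> 1" "r < n \<Longrightarrow> s r = 0" "r \<le> n"
    and "\<And>i. i < r \<Longrightarrow> s i \<ge> 1 / 8"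
  shows "real k * (\<Sum>i<r. walk n s k i) \<le> 8 * real n"
proof -
  let ?\<Phi> = "\<lambda>k i. if i < r then real r - real i + real k / 8 else 0"
  have "(\<Sum>i\<le>n. walk n s k i * ?\<Phi> k i) \<le> ?\<Phi> 0 0"
  proof (rule walk_expectation_le[where \<Phi> = ?\<Phi>])
    fix k i assume "i < n"
    show "s i * ?\<Phi> (Suc k) (Suc i) + (1 - s i) * ?\<Phi> (Suc k) i \<le> ?\<Phi> k i"
    proof (cases "i < r")
      case True
      define p where "p = ?\<Phi> (Suc k) (Suc i)"
      \<comment> \<open>Only an inequality: for \<open>Suc i = r\<close> the potential drops to 0,
        while the right side is \<open>real (Suc k) / 8\<close>.\<close>
      have "p \<le> real r - real i - 1 + real (Suc k) / 8" using True by (simp add: p_def)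
      then have "s i * p \<le> s i * (real r - real i - 1 + real (Suc k) / 8)"
        using assms(1)[OF \<open>i < n\<close>] by (intro mult_left_mono) auto
      moreover have "s i * (real r - real i - 1 + real (Suc k) / 8) + (1 - s i) * (real r - real i + real (Suc k) / 8) =
          real r - real i + real k / 8 + (1 / 8 - s i)"
        by (simp add: field_simps)
      ultimately have "s i * p + (1 - s i) * (real r - real i + real (Suc k) / 8) \<le> real r - real i + real k / 8"
        using assms(4)[OF True] by linarith
      then show ?thesis by (simp only: p_def True if_True)
    next
      case False
      then show ?thesis by simp
    qed
  qed (use assms in auto)
  also have "\<dots> \<le> real n" using assms(3) by simp
  finally have *: "(\<Sum>i\<le>n. walk n s k i * ?\<Phi> k i) \<le> real n" .
  have "real k / 8 * (\<Sum>i<r. walk n s k i) = (\<Sum>i<r. walk n s k i * (real k / 8))"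
    by (simp add: sum_distrib_left mult.commute)
  also have "\<dots> \<le> (\<Sum>i<r. walk n s k i * ?\<Phi> k i)"
    by (intro sum_mono mult_left_mono walk_nonneg[OF assms(1)]) auto
  also have "\<dots> \<le> (\<Sum>i\<le>n. walk n s k i * ?\<Phi> k i)"
    using assms(3) by (intro sum_mono2 mult_nonneg_nonneg walk_nonneg[OF assms(1)]) auto
  also note *
  finally show ?thesis by simp
qed

section \<open>The degree bound for zero-error algorithms\<close>

text \<open>Polynomials of degree at most \<open>d\<close> in the input bits; \<open>var\<close>
  multiplies by the bit of \<open>j\<close>. The rules match what queries and unitaries do to
  amplitudes.\<close>

inductive bool_degree_le :: "nat \<Rightarrow> ('i set \<Rightarrow> complex) \<Rightarrow> bool" where
  const: "bool_degree_le d (\<lambda>_. c)"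
| add: "bool_degree_le d p \<Longrightarrow> bool_degree_le d q \<Longrightarrow> bool_degree_le d (\<lambda>x. p x + q x)"
| cmult: "bool_degree_le d p \<Longrightarrow> bool_degree_le d (\<lambda>x. c * p x)"
| var: "bool_degree_le d p \<Longrightarrow> bool_degree_le (Suc d) (\<lambda>x. if j \<in> x then p x else 0)"

lemma bool_degree_le_sum:
  assumes "\<And>s. s \<in> S \<Longrightarrow> bool_degree_le d (p s)"
  shows "bool_degree_le d (\<lambda>x. \<Sum>s\<in>S. p s x)"
  using assms
  by (induction S rule: infinite_finite_induct) (auto intro: bool_degree_le.intros)

lemma bool_degree_le_Suc: "bool_degree_le d p \<Longrightarrow> bool_degree_le (Suc d) p"
  by (induction rule: bool_degree_le.induct) (auto intro: bool_degree_le.intros)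

text \<open>A query adds to an amplitude the bit of \<open>j\<close> times its difference from the
  amplitude with the other answer bit.\<close>

lemma bool_degree_le_query:
  assumes "\<And>s. bool_degree_le d (\<lambda>x. \<psi> x s)"
  shows "bool_degree_le (Suc d) (\<lambda>x. query_gate x (\<psi> x) s)"
proof -
  obtain j b z where s: "s = (j, b, z)" by (cases s)
  have "bool_degree_le (Suc d) (\<lambda>x. \<psi> x (j, b, z) + (if j \<in> x then \<psi> x (j, \<not> b, z) + (-1) * \<psi> x (j, b, z) else 0))"
    by (intro bool_degree_le.intros assms bool_degree_le_Suc)
  also have "(\<lambda>x. \<psi> x (j, b, z) + (if j \<in> x then \<psi> x (j, \<not> b, z) + (-1) * \<psi> x (j, b, z) else 0)) =
      (\<lambda>x. query_gate x (\<psi> x) s)"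
    by (auto simp: query_gate_def s)
  finally show ?thesis .
qed

lemma bool_degree_le_state_after: "bool_degree_le k (\<lambda>x. state_after I A x k s)"
proof (induction k arbitrary: s)
  case 0
  then show ?case by (simp add: bool_degree_le.const)
next
  case (Suc k)
  have "bool_degree_le (Suc k) (\<lambda>x. query_gate x (state_after I A x k) s)" for s
    by (rule bool_degree_le_query) (rule Suc.IH)
  then show ?case
    unfolding state_after.simps apply_matrix_def
    by (intro bool_degree_le_sum bool_degree_le.cmult)
qed

lemma sum_Pow_insert:
  assumes "finite G" "j \<notin> G"
  shows "(\<Sum>H\<in>Pow (insert j G). f H) = (\<Sum>H\<in>Pow G. f H) + (\<Sum>H\<in>Pow G. f (insert j H))"
proof -
  have "(\<Sum>H\<in>Pow (insert j G). f H) = (\<Sum>H\<in>Pow G. f H) + (\<Sum>H\<in>insert j ` Pow G. f H)"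
    unfolding Pow_insert using assms by (intro sum.union_disjoint) auto
  also have "(\<Sum>H\<in>insert j ` Pow G. f H) = (\<Sum>H\<in>Pow G. f (insert j H))"
    using assms(2) by (intro sum.reindex[unfolded comp_def] inj_onI) (auto simp: insert_ident)
  finally show ?thesis .
qed

text \<open>Up to sign, the sum is the coefficient of the product of all bits in \<open>G\<close>
  once the bits in \<open>B\<close> are fixed to 1. Constants cancel in pairs \<open>H\<close>,
  \<open>insert j H\<close>. For \<open>var\<close> with \<open>j\<close> in \<open>G\<close> but
  not in \<open>B\<close>, only the \<open>H\<close> containing \<open>j\<close> contribute, so
  \<open>j\<close> moves from \<open>G\<close> to \<open>B\<close> and both sides of
  \<open>card G > d\<close> drop by one.\<close>

lemma alternating_sum_low_degree:
  assumes "bool_degree_le d p" "finite G" "card G > d"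
  shows "(\<Sum>H\<in>Pow G. (-1) ^ card H * p (B \<union> H)) = 0"
  using assms
proof (induction arbitrary: G B)
  case (const d c)
  then obtain j where "j \<in> G" by fastforce
  then have G: "G = insert j (G - {j})" by auto
  have "(\<Sum>H\<in>Pow G. (-1) ^ card H * c) = (\<Sum>H\<in>Pow (G - {j}). (-1) ^ card H * c + (-1) ^ card (insert j H) * c)"
    by (subst G, subst sum_Pow_insert) (use const in \<open>auto simp: sum.distrib\<close>)
  also have "\<dots> = 0"
  proof (intro sum.neutral ballI)
    fix H assume "H \<in> Pow (G - {j})"
    then have "j \<notin> H" "finite H" using const by (auto intro: finite_subset)
    then show "(-1) ^ card H * c + (-1) ^ card (insert j H) * c = 0" by simp
  qed
  finally show ?case .
next
  case (add d p q)
  then show ?case by (simp add: algebra_simps sum.distrib)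
next
  case (cmult d p c)
  have "(\<Sum>H\<in>Pow G. (-1) ^ card H * (c * p (B \<union> H))) = c * (\<Sum>H\<in>Pow G. (-1) ^ card H * p (B \<union> H))"
    by (simp add: sum_distrib_left algebra_simps)
  then show ?case using cmult by simp
next
  case (var d p j)
  show ?case
  proof (cases "j \<in> G")
    case True
    then have G: "G = insert j (G - {j})" by auto
    have fin: "finite H" "j \<notin> H" if "H \<in> Pow (G - {j})" for H
      using that var by (auto intro: finite_subset)
    have 1: "(\<Sum>H\<in>Pow (G - {j}). (-1) ^ card (insert j H) * p (B \<union> insert j H)) =
        - (\<Sum>H\<in>Pow (G - {j}). (-1) ^ card H * p (insert j B \<union> H))"
      by (subst sum_negf[symmetric], rule sum.cong) (use fin in auto)
    also have "\<dots> = 0"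
      using var.IH[of "G - {j}" "insert j B"] var.prems True by simp
    finally have 0: "(\<Sum>H\<in>Pow (G - {j}). (-1) ^ card (insert j H) * p (B \<union> insert j H)) = 0" .
    show ?thesis
    proof (cases "j \<in> B")
      case True
      then show ?thesis using var by simp
    next
      case False
      have "(\<Sum>H\<in>Pow G. (-1) ^ card H * (if j \<in> B \<union> H then p (B \<union> H) else 0)) =
         (\<Sum>H\<in>Pow (G - {j}). (-1) ^ card H * (if j \<in> B \<union> H then p (B \<union> H) else 0)) +
         (\<Sum>H\<in>Pow (G - {j}). (-1) ^ card (insert j H) * p (B \<union> insert j H))"
        by (subst G, subst sum_Pow_insert) (use var in auto)
      also have "(\<Sum>H\<in>Pow (G - {j}). (-1) ^ card H * (if j \<in> B \<union> H then p (B \<union> H) else 0)) = 0"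
        using False fin by (intro sum.neutral) auto
      finally show ?thesis using 0 by simp
    qed
  next
    case False
    show ?thesis
    proof (cases "j \<in> B")
      case True
      then show ?thesis using var by simp
    next
      case False
      with \<open>j \<notin> G\<close> show ?thesis by (intro sum.neutral) auto
    qed
  qed
qed

section \<open>Final amplitudes of zero-error algorithms\<close>

lemma unitary_preserves_norm:
  assumes "finite B" "unitary_on B U"
  shows "(\<Sum>s\<in>B. (cmod (apply_matrix B U \<psi> s))\<^sup>2) = (\<Sum>s\<in>B. (cmod (\<psi> s))\<^sup>2)"
proof -
  have "complex_of_real (\<Sum>s\<in>B. (cmod (apply_matrix B U \<psi> s))\<^sup>2) =
      (\<Sum>s\<in>B. (\<Sum>t'\<in>B. U s t' * \<psi> t') * (\<Sum>t\<in>B. cnj (U s t) * cnj (\<psi> t)))"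
    by (simp only: of_real_sum complex_norm_square) (simp add: apply_matrix_def)
  also have "\<dots> = (\<Sum>s\<in>B. \<Sum>t'\<in>B. \<Sum>t\<in>B. (cnj (U s t) * U s t') * (\<psi> t' * cnj (\<psi> t)))"
    by (simp add: sum_product algebra_simps)
  also have "\<dots> = (\<Sum>t'\<in>B. \<Sum>t\<in>B. \<Sum>s\<in>B. (cnj (U s t) * U s t') * (\<psi> t' * cnj (\<psi> t)))"
    by (subst sum.swap, rule sum.cong[OF refl], rule sum.swap)
  also have "\<dots> = (\<Sum>t'\<in>B. \<Sum>t\<in>B. (if t = t' then 1 else 0) * (\<psi> t' * cnj (\<psi> t)))"
    using assms(2) by (intro sum.cong refl) (simp add: unitary_on_def flip: sum_distrib_right)
  also have "\<dots> = (\<Sum>t'\<in>B. \<Sum>t\<in>B. if t = t' then \<psi> t' * cnj (\<psi> t) else 0)"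
    by (intro sum.cong refl) simp
  also have "\<dots> = complex_of_real (\<Sum>s\<in>B. (cmod (\<psi> s))\<^sup>2)"
    using assms(1) by (simp only: of_real_sum complex_norm_square) simp
  finally show ?thesis by (simp only: of_real_eq_iff)
qed

lemma query_preserves_norm:
  "(\<Sum>s\<in>qbasis I w. (cmod (query_gate x \<psi> s))\<^sup>2) = (\<Sum>s\<in>qbasis I w. (cmod (\<psi> s))\<^sup>2)"
proof -
  let ?h = "\<lambda>(j, b, z). (j, b \<noteq> (j \<in> x), z)"
  have "bij_betw ?h (qbasis I w) (qbasis I w)"
    by (rule bij_betwI[where g = ?h]) (auto simp: qbasis_def)
  from sum.reindex_bij_betw[OF this, of "\<lambda>s. (cmod (\<psi> s))\<^sup>2"] show ?thesis
    by (simp add: query_gate_def case_prod_unfold)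
qed

lemma norm_state_after:
  assumes "is_qalg I A" "finite I" "k \<le> num_queries A"
  shows "(\<Sum>s\<in>alg_basis I A. (cmod (state_after I A x k s))\<^sup>2) = 1"
  using assms(3)
proof (induction k)
  have fin: "finite (alg_basis I A)" using assms(2) by (simp add: alg_basis_def qbasis_def)
  {
    case 0
    have "(\<Sum>s\<in>alg_basis I A. (cmod (if s = start_state A then 1 else 0))\<^sup>2) =
        (\<Sum>s\<in>alg_basis I A. if s = start_state A then 1 else 0)"
      by (rule sum.cong) auto
    then show ?case
      using assms fin by (simp add: unitary_preserves_norm is_qalg_def)
  next
    case (Suc k)
    then show ?case
      using assms fin by (simp add: unitary_preserves_norm is_qalg_def)
        (simp add: alg_basis_def query_preserves_norm)
  }
qed

lemma exists_output_state:
  assumes "is_qalg I A" "zero_error_computes I A f" "finite I" "x \<subseteq> I"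
  obtains s where "s \<in> alg_basis I A" "result A s = Some (f x)" "state_after I A x (num_queries A) s \<noteq> 0"
proof -
  let ?p = "\<lambda>s. (cmod (state_after I A x (num_queries A) s))\<^sup>2"
  have fin: "finite (alg_basis I A)" using assms(3) by (simp add: alg_basis_def qbasis_def)
  have "1 = (\<Sum>s\<in>alg_basis I A. ?p s)"
    using norm_state_after[OF assms(1,3)] by simp
  also have "\<dots> = (\<Sum>v\<in>UNIV. \<Sum>s | s \<in> alg_basis I A \<and> result A s = v. ?p s)"
    using sum.group[OF fin, of UNIV "result A" ?p] by simp
  also have "\<dots> = output_prob I A x None + output_prob I A x (Some True) + output_prob I A x (Some False)"
    by (simp add: output_prob_def UNIV_option_conv UNIV_bool)
  finally have total: "1 = output_prob I A x None + output_prob I A x (Some True) + output_prob I A x (Some False)" .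
  have "output_prob I A x (Some (\<not> f x)) = 0" "output_prob I A x None \<le> 1 / 2"
    using assms(2,4) by (auto simp: zero_error_computes_def)
  then have "output_prob I A x (Some (f x)) \<noteq> 0"
    using total by (cases "f x") auto
  then obtain s where "s \<in> {s. s \<in> alg_basis I A \<and> result A s = Some (f x)}" "?p s \<noteq> 0"
    unfolding output_prob_def by (rule sum.not_neutral_contains_not_neutral)
  then show thesis using that[of s] by simp
qed

lemma zero_output_state:
  assumes "zero_error_computes I A f" "finite I" "x \<subseteq> I"
    and "s \<in> alg_basis I A" "result A s = Some (\<not> f x)"
  shows "state_after I A x (num_queries A) s = 0"
proof -
  have "finite (alg_basis I A)" using assms(2) by (simp add: alg_basis_def qbasis_def)
  moreover have "output_prob I A x (Some (\<not> f x)) = 0"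
    using assms by (auto simp: zero_error_computes_def)
  ultimately show ?thesis
    using assms(4,5) by (cases s) (auto simp: output_prob_def sum_nonneg_eq_0_iff)
qed

text \<open>On the cube of all \<open>B \<union> H\<close> with \<open>H \<subseteq> G\<close>, an amplitude leading to the answer \<open>f (B \<union> H0)\<close>
  is nonzero at \<open>H0\<close> only, hence its degree is \<open>card G\<close>.\<close>

lemma zero_error_queries_ge:
  assumes "is_qalg I A" "zero_error_computes I A f" "finite I" "B \<union> G \<subseteq> I"
    and "H0 \<subseteq> G" "\<And>H. H \<subseteq> G \<Longrightarrow> H \<noteq> H0 \<Longrightarrow> f (B \<union> H) \<noteq> f (B \<union> H0)"
  shows "card G \<le> num_queries A"
proof (rule ccontr)
  assume "\<not> card G \<le> num_queries A"
  have fin: "finite G" using assms(3,4) finite_subset by blast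
  obtain s where s: "s \<in> alg_basis I A" "result A s = Some (f (B \<union> H0))"
      "state_after I A (B \<union> H0) (num_queries A) s \<noteq> 0"
    using exists_output_state[OF assms(1-3), of "B \<union> H0"] assms(4,5) by blast
  define q where "q x = state_after I A x (num_queries A) s" for x
  have "q (B \<union> H) = 0" if "H \<subseteq> G" "H \<noteq> H0" for H
    unfolding q_def
    by (rule zero_output_state[OF assms(2,3)]) (use assms(4,6) that s in auto)
  then have "(\<Sum>H\<in>Pow G. (-1) ^ card H * q (B \<union> H)) = (\<Sum>H\<in>{H0}. (-1) ^ card H * q (B \<union> H))"
    using assms(5) fin by (intro sum.mono_neutral_right) auto
  moreover have "(\<Sum>H\<in>Pow G. (-1) ^ card H * q (B \<union> H)) = 0"
    using \<open>\<not> card G \<le> num_queries A\<close> fin unfolding q_def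
    by (intro alternating_sum_low_degree[OF bool_degree_le_state_after]) auto
  ultimately show False using s(3) by (simp add: q_def)
qed

section \<open>Vertex permutations acting on edges, and the lower bound for graph properties\<close>

lemma edges_Sigma: "edges n = (SIGMA i:{..<n}. {..<n} - {i})"
  by (auto simp: edges_def)

lemma finite_edges: "finite (edges n)"
  by (simp add: edges_Sigma)

lemma card_edges: "card (edges n) = n * (n - 1)"
  by (simp add: edges_Sigma)

lemma map_prod_edges:
  assumes "\<pi> permutes {..<n}" "e \<in> edges n"
  shows "map_prod \<pi> \<pi> e \<in> edges n"
proof -
  have "\<pi> i < n \<longleftrightarrow> i < n" for i using permutes_in_image[OF assms(1), of i] by simp
  moreover have "\<pi> i = \<pi> j \<longleftrightarrow> i = j" for i j using permutes_inj[OF assms(1)] by (simp add: inj_eq)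
  ultimately show ?thesis using assms(2) by (cases e) (simp add: edges_def)
qed

lemma edges_transitive:
  assumes "e \<in> edges n" "e' \<in> edges n"
  obtains \<sigma> where "\<sigma> permutes {..<n}" "map_prod \<sigma> \<sigma> e = e'"
proof -
  obtain a b c d where e: "e = (a, b)" "e' = (c, d)" by (cases e, cases e')
  \<comment> \<open>\<open>b'\<close> is where \<open>b\<close> lands when \<open>a\<close> is moved
    to \<open>c\<close>. Neither \<open>b'\<close> nor \<open>d\<close> equals \<open>c\<close>, so
    the second transposition keeps \<open>c\<close> in place.\<close>
  define b' where "b' = Transposition.transpose a c b"
  define \<sigma> where "\<sigma> = Transposition.transpose b' d \<circ> Transposition.transpose a c"
  have lt: "a < n" "b < n" "c < n" "d < n" "a \<noteq> b" "c \<noteq> d" using assms by (auto simp: edges_def e)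
  then have "b' < n" "b' \<noteq> c" by (auto simp: b'_def Transposition.transpose_def)
  then have "\<sigma> permutes {..<n}" unfolding \<sigma>_def using lt
    by (intro permutes_compose permutes_swap_id) auto
  moreover have "\<sigma> a = c" using lt \<open>b' \<noteq> c\<close> by (simp add: \<sigma>_def transpose_apply_other)
  moreover have "\<sigma> b = d" by (simp add: \<sigma>_def flip: b'_def)
  ultimately show thesis using that by (simp add: e)
qed

text \<open>Orbit-stabilizer count: the permutations are partitioned by the image of
  \<open>e\<close>, and composing with a permutation that takes \<open>e1\<close> to
  \<open>e2\<close> injects one class into the other.\<close>

lemma card_permutations_mapping_edge:
  assumes "e \<in> edges n" "e' \<in> edges n"
  shows "card (edges n) * card {\<pi>. \<pi> permutes {..<n} \<and> map_prod \<pi> \<pi> e = e'} =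
         card {\<pi>. \<pi> permutes {..<n}}"
proof -
  let ?C = "\<lambda>e'. {\<pi>. \<pi> permutes {..<n} \<and> map_prod \<pi> \<pi> e = e'}"
  have fin: "finite {\<pi>. \<pi> permutes {..<n}}" by (simp add: finite_permutations)
  have le: "card (?C e1) \<le> card (?C e2)" if "e1 \<in> edges n" "e2 \<in> edges n" for e1 e2
  proof -
    from edges_transitive[OF that] obtain \<sigma> where
      \<sigma>: "\<sigma> permutes {..<n}" "map_prod \<sigma> \<sigma> e1 = e2" .
    have "inj_on ((\<circ>) \<sigma>) (?C e1)"
      using permutes_inj[OF \<sigma>(1)] by (auto intro!: inj_onI simp: fun_eq_iff inj_eq)
    moreover have "(\<circ>) \<sigma> ` ?C e1 \<subseteq> ?C e2"
      using \<sigma> by (auto intro: permutes_compose simp: map_prod_def split: prod.splits)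
    ultimately show ?thesis
      using fin by (intro card_inj_on_le[of "(\<circ>) \<sigma>"]) auto
  qed
  have "card {\<pi>. \<pi> permutes {..<n}} = card (\<Union>e1\<in>edges n. ?C e1)"
    using map_prod_edges[OF _ assms(1)] by (intro arg_cong[of _ _ card]) auto
  also have "\<dots> = (\<Sum>e1\<in>edges n. card (?C e1))"
    using fin by (intro card_UN_disjoint finite_edges) auto
  also have "\<dots> = (\<Sum>e1\<in>edges n. card (?C e'))"
    by (intro sum.cong refl antisym le assms(2))
  finally show ?thesis by simp
qed

text \<open>On average over the permutations \<open>\<pi>\<close>, the image of \<open>G\<close> meets \<open>L\<close> in
  \<open>card G * card L / card (edges n)\<close> edges.\<close>

lemma card_edges_le_of_always_meeting:
  assumes "G \<subseteq> edges n" "L \<subseteq> edges n"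
    and meet: "\<And>\<pi>. \<pi> permutes {..<n} \<Longrightarrow> map_prod \<pi> \<pi> ` G \<inter> L \<noteq> {}"
  shows "card (edges n) \<le> card G * card L"
proof -
  let ?P = "{\<pi>. \<pi> permutes {..<n}}"
  have fin: "finite ?P" by (simp add: finite_permutations)
  have fin': "finite G" "finite L" using assms finite_edges finite_subset by blast+
  have one: "1 \<le> (\<Sum>e\<in>G. \<Sum>e'\<in>L. of_bool (map_prod \<pi> \<pi> e = e') :: nat)" if "\<pi> \<in> ?P" for \<pi>
  proof -
    from that have "map_prod \<pi> \<pi> ` G \<inter> L \<noteq> {}" using meet by simp
    then obtain e' where "e' \<in> map_prod \<pi> \<pi> ` G" and L: "e' \<in> L" by blast
    from this(1) obtain e where e: "e \<in> G" "map_prod \<pi> \<pi> e = e'" by (elim imageE) simp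
    have "of_bool (map_prod \<pi> \<pi> e = e') \<le> (\<Sum>e'\<in>L. of_bool (map_prod \<pi> \<pi> e = e') :: nat)"
      using L fin' by (intro member_le_sum) auto
    also have "\<dots> \<le> (\<Sum>e\<in>G. \<Sum>e'\<in>L. of_bool (map_prod \<pi> \<pi> e = e'))"
      using e(1) fin' by (intro member_le_sum[where f = "\<lambda>e. \<Sum>e'\<in>L. of_bool (map_prod \<pi> \<pi> e = e')"]) auto
    finally show ?thesis using e(2) by simp
  qed
  have "card ?P = (\<Sum>\<pi>\<in>?P. 1)" by simp
  also have "\<dots> \<le> (\<Sum>\<pi>\<in>?P. \<Sum>e\<in>G. \<Sum>e'\<in>L. of_bool (map_prod \<pi> \<pi> e = e'))"
    by (intro sum_mono one)
  also have "\<dots> = (\<Sum>e\<in>G. \<Sum>e'\<in>L. \<Sum>\<pi>\<in>?P. of_bool (map_prod \<pi> \<pi> e = e'))"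
    by (subst sum.swap, rule sum.cong[OF refl], rule sum.swap)
  also have "\<dots> = (\<Sum>e\<in>G. \<Sum>e'\<in>L. card {\<pi>. \<pi> permutes {..<n} \<and> map_prod \<pi> \<pi> e = e'})"
    using fin by (intro sum.cong refl) (simp add: Int_def)
  finally have "card (edges n) * card ?P \<le>
      card (edges n) * (\<Sum>e\<in>G. \<Sum>e'\<in>L. card {\<pi>. \<pi> permutes {..<n} \<and> map_prod \<pi> \<pi> e = e'})"
    by simp
  also have "\<dots> = (\<Sum>e\<in>G. \<Sum>e'\<in>L. card ?P)"
    unfolding sum_distrib_left
    using assms(1,2) by (intro sum.cong refl card_permutations_mapping_edge) auto
  also have "\<dots> = (card G * card L) * card ?P" by simp
  finally have "card (edges n) * card ?P \<le> (card G * card L) * card ?P" .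
  moreover have "card ?P > 0" by (simp add: card_permutations)
  ultimately show ?thesis by simp
qed

lemma minimal_subset_exists:
  assumes "finite I" "Q X" "X \<subseteq> I"
  obtains G where "G \<subseteq> I" "Q G" "\<And>H. H \<subset> G \<Longrightarrow> \<not> Q H"
proof -
  have "\<exists>G. G \<subseteq> I \<and> Q G \<and> (\<forall>H. H \<subset> G \<longrightarrow> \<not> Q H)"
    using assms
  proof (induction "card X" arbitrary: X rule: less_induct)
    case less
    show ?case
    proof (cases "\<exists>H. H \<subset> X \<and> Q H")
      case True
      then obtain H where "H \<subset> X" "Q H" by blast
      then show ?thesis
        using less.hyps[of H] less.prems psubset_card_mono[of X H] finite_subset[of X I] by auto
    next
      case False
      then show ?thesis using less.prems by blast
    qed
  qed
  then show thesis using that by blast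
qed

lemma Q0_graph_property_ge:
  assumes P: "nonconstant_monotone_graph_property n P" and "n \<ge> 2"
    and A: "is_qalg (edges n) A" "zero_error_computes (edges n) A P"
  shows "n - 1 \<le> num_queries A"
proof -
  let ?E = "edges n"
  have inv: "P (map_prod \<pi> \<pi> ` G) = P G" if "\<pi> permutes {..<n}" "G \<subseteq> ?E" for \<pi> G
    using P that by (auto simp: nonconstant_monotone_graph_property_def graph_property_def)
  have mono: "P H" if "P G" "G \<subseteq> H" "H \<subseteq> ?E" for G H
    using P that by (auto simp: nonconstant_monotone_graph_property_def monotone_property_def)
  obtain G0 H0 where GH: "G0 \<subseteq> ?E" "P G0" "H0 \<subseteq> ?E" "\<not> P H0"
    using P by (auto simp: nonconstant_monotone_graph_property_def nonconstant_property_def)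
  obtain G where G: "G \<subseteq> ?E" "P G" "\<And>H. H \<subset> G \<Longrightarrow> \<not> P H"
    using minimal_subset_exists[OF finite_edges, of P G0 n] GH by blast
  \<comment> \<open>Passing to complements lets \<open>minimal_subset_exists\<close> also produce a
    maximal graph without the property, namely \<open>?E - L\<close>.\<close>
  have "\<not> P (?E - (?E - H0))" using GH by (simp add: double_diff)
  then obtain L where L: "L \<subseteq> ?E" "\<not> P (?E - L)" "\<And>H. H \<subset> L \<Longrightarrow> \<not> \<not> P (?E - H)"
    using minimal_subset_exists[OF finite_edges, of "\<lambda>L. \<not> P (?E - L)" "?E - H0" n] by blast
  have k: "card G \<le> num_queries A"
    by (rule zero_error_queries_ge[OF A finite_edges, of "{}" G G]) (use G in auto)
  \<comment> \<open>With all edges outside \<open>L\<close> present, the property is the disjunction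
    of the bits in \<open>L\<close>; the empty set is its isolated point.\<close>
  have l: "card L \<le> num_queries A"
  proof (rule zero_error_queries_ge[OF A finite_edges, of "?E - L" L "{}"])
    fix H assume "H \<subseteq> L" "H \<noteq> {}"
    then have "P (?E - (L - H))" by (intro L(3)[simplified]) auto
    moreover have "?E - (L - H) = (?E - L) \<union> H" using \<open>H \<subseteq> L\<close> L(1) by auto
    ultimately show "P (?E - L \<union> H) \<noteq> P (?E - L \<union> {})" using L(2) by simp
  qed (use L(1) in auto)
  have "card ?E \<le> card G * card L"
  proof (rule card_edges_le_of_always_meeting[OF G(1) L(1)])
    fix \<pi> assume \<pi>: "\<pi> permutes {..<n}"
    show "map_prod \<pi> \<pi> ` G \<inter> L \<noteq> {}"
    proof
      assume disj: "map_prod \<pi> \<pi> ` G \<inter> L = {}"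
      have "map_prod \<pi> \<pi> ` G \<subseteq> ?E"
        by (intro image_subsetI map_prod_edges[OF \<pi>]) (use G(1) in blast)
      then have "map_prod \<pi> \<pi> ` G \<subseteq> ?E - L" using disj by blast
      moreover have "P (map_prod \<pi> \<pi> ` G)" using inv[OF \<pi> G(1)] G(2) by simp
      ultimately have "P (?E - L)" using mono by blast
      then show False using L(2) by simp
    qed
  qed
  also have "\<dots> \<le> num_queries A * num_queries A" using k l by (rule mult_le_mono)
  finally have *: "n * (n - 1) \<le> (num_queries A)\<^sup>2" by (simp add: card_edges power2_eq_square)
  have "(n - 1)\<^sup>2 \<le> n * (n - 1)" unfolding power2_eq_square by (rule mult_le_mono1) simp
  also note *
  finally have "(n - 1)\<^sup>2 \<le> (num_queries A)\<^sup>2" .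
  then show ?thesis by (simp add: power2_nat_le_eq_le)
qed

section \<open>Full rows and randomized decision trees\<close>

definition has_full_row :: "nat \<Rightarrow> (nat \<times> nat) set \<Rightarrow> bool" where
  "has_full_row n G \<longleftrightarrow> (\<exists>i<n. {i} \<times> ({..<n} - {i}) \<subseteq> G)"

text \<open>The queries on the path taken by \<open>x\<close>, as a set: repetitions count
  once.\<close>

primrec queried_on :: "'i dtree \<Rightarrow> 'i set \<Rightarrow> 'i set" where
  "queried_on (Leaf b) x = {}"
| "queried_on (Query j t0 t1) x = insert j (if j \<in> x then queried_on t1 x else queried_on t0 x)"

lemma finite_queried_on: "finite (queried_on t x)"
  by (induction t) auto

lemma card_queried_on_le: "card (queried_on t x) \<le> dtree_cost t x"
proof (induction t)
  case (Query j t0 t1)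
  have "card (queried_on (Query j t0 t1) x) \<le> Suc (card (if j \<in> x then queried_on t1 x else queried_on t0 x))"
    by (simp add: card_insert_le_m1 card_insert_if finite_queried_on)
  with Query show ?case by auto
qed simp

lemma dtree_value_cong:
  assumes "\<And>j. j \<in> queried_on t x \<Longrightarrow> j \<in> x \<longleftrightarrow> j \<in> y"
  shows "dtree_value t x = dtree_value t y"
  using assms
proof (induction t)
  case (Query j t0 t1)
  then show ?case by (cases "j \<in> x") auto
qed simp

text \<open>A new query in row \<open>r\<close> hits the missing edge for one of the remaining positions \<open>z \<in> Z\<close>, and costs one
  query for each of them.\<close>

lemma row_hits_le:
  assumes "finite Z" "{r} \<times> Z \<subseteq> X"
  shows "card Z * (\<Sum>z\<in>Z. of_bool ((r, z) \<in> queried_on t (X - {(r, z)}))) \<le>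
     2 * (\<Sum>z\<in>Z. card {z' \<in> Z. (r, z') \<in> queried_on t (X - {(r, z)})})"
  using assms
proof (induction t arbitrary: Z)
  case (Leaf b)
  then show ?case by simp
next
  case (Query e t0 t1)
  show ?case
  proof (cases "e \<in> {r} \<times> Z")
    case False
    define t where "t = (if e \<in> X then t1 else t0)"
    have "queried_on (Query e t0 t1) (X - {(r, z)}) = insert e (queried_on t (X - {(r, z)}))" if "z \<in> Z" for z
      using False that by (auto simp: t_def)
    moreover have "(r, z) \<in> insert e Y \<longleftrightarrow> (r, z) \<in> Y" if "z \<in> Z" for z Y
      using False that by auto
    ultimately have *: "(r, z') \<in> queried_on (Query e t0 t1) (X - {(r, z)}) \<longleftrightarrow> (r, z') \<in> queried_on t (X - {(r, z)})"
      if "z \<in> Z" "z' \<in> Z" for z z'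
      using that by simp
    have "card Z * (\<Sum>z\<in>Z. of_bool ((r, z) \<in> queried_on t (X - {(r, z)}))) \<le>
       2 * (\<Sum>z\<in>Z. card {z' \<in> Z. (r, z') \<in> queried_on t (X - {(r, z)})})"
      using Query by (simp add: t_def)
    then show ?thesis using * by (simp add: conj_commute cong: conj_cong del: queried_on.simps)
  next
    case True
    then obtain z0 where e: "e = (r, z0)" and z0: "z0 \<in> Z" by blast
    \<comment> \<open>Only the input lacking \<open>(r, z0)\<close> leaves for \<open>t0\<close>,
      with its hit already counted. The others continue in \<open>t1\<close>, with \<open>z0\<close>
      no longer a candidate.\<close>
    define Z' where "Z' = Z - {z0}"
    have Z: "Z = insert z0 Z'" "z0 \<notin> Z'" "finite Z'" using z0 Query.prems by (auto simp: Z'_def)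
    have p1: "queried_on (Query e t0 t1) (X - {(r, z)}) = insert (r, z0) (queried_on t1 (X - {(r, z)}))" if "z \<in> Z'" for z
      using that Query.prems(2) z0 Z(2) by (auto simp: e)
    define h where "h = (\<Sum>z\<in>Z'. of_bool ((r, z) \<in> queried_on t1 (X - {(r, z)})) :: nat)"
    define S where "S = (\<Sum>z\<in>Z'. card {z' \<in> Z'. (r, z') \<in> queried_on t1 (X - {(r, z)})})"
    have IH: "card Z' * h \<le> 2 * S"
      using Query.IH(2)[of Z'] Query.prems Z by (auto simp: h_def S_def)
    have "h \<le> (\<Sum>z\<in>Z'. 1)" unfolding h_def by (rule sum_mono) auto
    then have h: "h \<le> card Z'" by simp
    have hits: "(\<Sum>z\<in>Z. of_bool ((r, z) \<in> queried_on (Query e t0 t1) (X - {(r, z)}))) = 1 + h"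
    proof -
      have "(\<Sum>z\<in>Z'. of_bool ((r, z) \<in> queried_on (Query e t0 t1) (X - {(r, z)}))) = h"
        unfolding h_def using Z(2) by (intro sum.cong refl) (auto simp: p1 simp del: queried_on.simps)
      moreover have "(r, z0) \<in> queried_on (Query e t0 t1) (X - {(r, z0)})" by (simp add: e)
      ultimately show ?thesis unfolding Z(1) using Z by (simp del: queried_on.simps)
    qed
    define c where "c z = card {z' \<in> Z. (r, z') \<in> queried_on (Query e t0 t1) (X - {(r, z)})}" for z
    have queries: "card Z + S \<le> (\<Sum>z\<in>Z. c z)"
    proof -
      have "c z =
          Suc (card {z' \<in> Z'. (r, z') \<in> queried_on t1 (X - {(r, z)})})" if "z \<in> Z'" for z
      proof -
        have "{z' \<in> Z. (r, z') \<in> queried_on (Query e t0 t1) (X - {(r, z)})} =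
            insert z0 {z' \<in> Z'. (r, z') \<in> queried_on t1 (X - {(r, z)})}"
          using Z z0 by (auto simp: p1[OF that] simp del: queried_on.simps)
        then show ?thesis using Z by (simp add: c_def)
      qed
      then have "(\<Sum>z\<in>Z'. c z) = card Z' + S"
        by (simp add: S_def sum_Suc)
      moreover have "z0 \<in> {z' \<in> Z. (r, z') \<in> queried_on (Query e t0 t1) (X - {(r, z0)})}" using z0 by (simp add: e)
      then have "c z0 > 0"
        unfolding c_def using Query.prems(1) by (subst card_gt_0_iff) auto
      moreover have "(\<Sum>z\<in>Z. c z) = c z0 + (\<Sum>z\<in>Z'. c z)"
        using sum.remove[OF Query.prems(1) z0, of c] by (simp add: Z'_def)
      moreover have "card Z = Suc (card Z')" using Z by simp
      ultimately show ?thesis by linarith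
    qed
    \<comment> \<open>The factor 2 is what exhaustive search of N positions demands: N hits for N (N
      + 1) / 2 queries in total.\<close>
    have "card Z * (1 + h) = card Z + card Z' * h + h" using Z by simp
    also have "\<dots> \<le> 2 * (card Z + S)" using IH h Z by simp
    also note mult_le_mono2[OF queries, of 2]
    finally show ?thesis unfolding hits c_def .
  qed
qed

text \<open>Resampling one coordinate of a uniformly random choice function leaves it
  uniform.\<close>

lemma sum_PiE_update:
  fixes F :: "('a \<Rightarrow> 'b) \<Rightarrow> nat"
  assumes "r \<in> I"
  shows "(\<Sum>\<phi>\<in>PiE I C. \<Sum>z\<in>C r. F (\<phi>(r := z))) = card (C r) * (\<Sum>\<phi>\<in>PiE I C. F \<phi>)"
proof -
  define J where "J = I - {r}"
  have I: "I = insert r J" "r \<notin> J" using assms by (auto simp: J_def)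
  have sum_eq: "(\<Sum>\<phi>\<in>PiE I C. G \<phi>) = (\<Sum>y\<in>C r. \<Sum>\<psi>\<in>PiE J C. G (\<psi>(r := y)))" for G :: "('a \<Rightarrow> 'b) \<Rightarrow> nat"
    unfolding I(1) PiE_insert_eq
    by (subst sum.reindex[OF inj_combinator[OF I(2)]]) (simp add: sum.cartesian_product case_prod_unfold)
  have "(\<Sum>\<phi>\<in>PiE I C. \<Sum>z\<in>C r. F (\<phi>(r := z))) = (\<Sum>y\<in>C r. \<Sum>\<psi>\<in>PiE J C. \<Sum>z\<in>C r. F (\<psi>(r := z)))"
    by (simp add: sum_eq)
  also have "\<dots> = card (C r) * (\<Sum>z\<in>C r. \<Sum>\<psi>\<in>PiE J C. F (\<psi>(r := z)))"
    by (simp, subst sum.swap, simp)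
  finally show ?thesis by (simp add: sum_eq)
qed

text \<open>The hard inputs: they have no full row, but adding any missing edge creates one.\<close>

definition one_missing :: "nat \<Rightarrow> (nat \<Rightarrow> nat) \<Rightarrow> (nat \<times> nat) set" where
  "one_missing n \<phi> = edges n - {(i, \<phi> i) | i. i < n}"

abbreviation choices :: "nat \<Rightarrow> (nat \<Rightarrow> nat) set" where
  "choices n \<equiv> PiE {..<n} (\<lambda>i. {..<n} - {i})"

lemma finite_choices: "finite (choices n)"
  by (intro finite_PiE) auto

text \<open>For each row the other missing edges are frozen and only the one in this row is
  averaged, so \<open>row_hits_le\<close> applies to a graph with that row completed. Rows are
  disjoint, so their query counts add up to at most \<open>T\<close>.\<close>

lemma sum_hits_le:
  assumes "n \<ge> 2" "\<And>x. x \<subseteq> edges n \<Longrightarrow> dtree_cost t x \<le> T"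
  shows "(n - 1) * (\<Sum>\<phi>\<in>choices n. \<Sum>r<n. of_bool ((r, \<phi> r) \<in> queried_on t (one_missing n \<phi>))) \<le> 2 * T * card (choices n)"
proof -
  define h where "h \<phi> r = (of_bool ((r, \<phi> r) \<in> queried_on t (one_missing n \<phi>)) :: nat)" for \<phi> r
  define q where "q \<phi> r = card {z \<in> {..<n} - {r}. (r, z) \<in> queried_on t (one_missing n \<phi>)}" for \<phi> r
  have row: "(n - 1) * (\<Sum>z\<in>{..<n} - {r}. h (\<phi>(r := z)) r) \<le> 2 * (\<Sum>z\<in>{..<n} - {r}. q (\<phi>(r := z)) r)"
    if "r < n" for r \<phi>
  proof -
    define X where "X = edges n - {(i, \<phi> i) | i. i < n \<and> i \<noteq> r}"
    have "one_missing n (\<phi>(r := z)) = X - {(r, z)}" for z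
      using that by (auto simp: one_missing_def X_def)
    moreover have "{r} \<times> ({..<n} - {r}) \<subseteq> X"
      using that by (auto simp: X_def edges_def)
    ultimately show ?thesis
      using row_hits_le[of "{..<n} - {r}" r X t] that by (simp add: h_def q_def)
  qed
  have col: "(n - 1) * (\<Sum>\<phi>\<in>choices n. h \<phi> r) \<le> 2 * (\<Sum>\<phi>\<in>choices n. q \<phi> r)" if "r < n" for r
  proof -
    have c: "card ({..<n} - {r}) = n - 1" using that by simp
    have "(n - 1) * ((n - 1) * (\<Sum>\<phi>\<in>choices n. h \<phi> r)) = (\<Sum>\<phi>\<in>choices n. (n - 1) * (\<Sum>z\<in>{..<n} - {r}. h (\<phi>(r := z)) r))"
      using sum_PiE_update[of r "{..<n}" "\<lambda>\<phi>. h \<phi> r" "\<lambda>i. {..<n} - {i}"] that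
      by (simp only: sum_distrib_left[symmetric] c lessThan_iff)
    also have "\<dots> \<le> (\<Sum>\<phi>\<in>choices n. 2 * (\<Sum>z\<in>{..<n} - {r}. q (\<phi>(r := z)) r))"
      by (intro sum_mono row that)
    also have "\<dots> = 2 * ((n - 1) * (\<Sum>\<phi>\<in>choices n. q \<phi> r))"
      using sum_PiE_update[of r "{..<n}" "\<lambda>\<phi>. q \<phi> r" "\<lambda>i. {..<n} - {i}"] that
      by (simp only: sum_distrib_left[symmetric] c lessThan_iff)
    also have "\<dots> = (n - 1) * (2 * (\<Sum>\<phi>\<in>choices n. q \<phi> r))" by (simp only: mult.left_commute)
    finally show ?thesis using assms(1) by (simp only: mult_le_cancel1)
  qed
  have total: "(\<Sum>r<n. q \<phi> r) \<le> T" for \<phi>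
  proof -
    have "(\<Sum>r<n. q \<phi> r) = card (SIGMA r:{..<n}. {z \<in> {..<n} - {r}. (r, z) \<in> queried_on t (one_missing n \<phi>)})"
      by (simp add: q_def)
    also have "\<dots> \<le> card (queried_on t (one_missing n \<phi>))"
      by (intro card_mono finite_queried_on) auto
    also have "\<dots> \<le> T"
      using card_queried_on_le[of t "one_missing n \<phi>"] assms(2)[of "one_missing n \<phi>"] by (auto simp: one_missing_def)
    finally show ?thesis .
  qed
  have "(n - 1) * (\<Sum>\<phi>\<in>choices n. \<Sum>r<n. h \<phi> r) = (\<Sum>r<n. (n - 1) * (\<Sum>\<phi>\<in>choices n. h \<phi> r))"
    by (subst sum.swap) (simp add: sum_distrib_left)
  also have "\<dots> \<le> (\<Sum>r<n. 2 * (\<Sum>\<phi>\<in>choices n. q \<phi> r))"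
    by (intro sum_mono col) simp
  also have "\<dots> = 2 * (\<Sum>\<phi>\<in>choices n. \<Sum>r<n. q \<phi> r)"
    by (subst sum.swap) (simp add: sum_distrib_left)
  also have "\<dots> \<le> 2 * (\<Sum>\<phi>\<in>choices n. T)"
    by (intro mult_le_mono2 sum_mono total)
  finally show ?thesis by (simp add: h_def mult.commute mult.left_commute)
qed

text \<open>The correct answers differ before and after adding \<open>(r, \<phi> r)\<close>. Both
  are given with probability at least 2/3 + 2/3 - 1, and then the tree must have queried that
  edge.\<close>

lemma hit_prob_ge:
  assumes "bounded_error_computes (edges n) D (has_full_row n)" "\<phi> \<in> choices n" "r < n"
  shows "measure_pmf.prob D {t. (r, \<phi> r) \<in> queried_on t (one_missing n \<phi>)} \<ge> 1 / 3"
proof -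
  let ?x = "one_missing n \<phi>"
  let ?y = "insert (r, \<phi> r) ?x"
  have \<phi>: "\<phi> i < n" "\<phi> i \<noteq> i" if "i < n" for i
    using assms(2) that by (auto simp: PiE_iff)
  have sub: "?x \<subseteq> edges n" "?y \<subseteq> edges n"
    using \<phi>[OF assms(3)] assms(3) by (auto simp: one_missing_def edges_def)
  have "\<not> has_full_row n ?x"
  proof
    assume "has_full_row n ?x"
    then obtain i where "i < n" "{i} \<times> ({..<n} - {i}) \<subseteq> ?x" by (auto simp: has_full_row_def)
    then show False using \<phi>[of i] by (auto simp: one_missing_def)
  qed
  moreover have "has_full_row n ?y"
    unfolding has_full_row_def using assms(3)
    by (intro exI[of _ r]) (auto simp: one_missing_def edges_def)
  moreover have "measure_pmf.prob D {t. dtree_value t ?x = has_full_row n ?x} \<ge> 2 / 3"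
      "measure_pmf.prob D {t. dtree_value t ?y = has_full_row n ?y} \<ge> 2 / 3"
    using assms(1) sub unfolding bounded_error_computes_def by blast+
  ultimately have AB: "measure_pmf.prob D {t. \<not> dtree_value t ?x} \<ge> 2 / 3"
      "measure_pmf.prob D {t. dtree_value t ?y} \<ge> 2 / 3"
    by simp_all
  let ?A = "{t. \<not> dtree_value t ?x}" and ?B = "{t. dtree_value t ?y}"
  have "measure_pmf.prob D (?A - ?B) = measure_pmf.prob D ?A - measure_pmf.prob D (?A \<inter> ?B)"
    by (rule measure_pmf.finite_measure_Diff') auto
  moreover have "measure_pmf.prob D (?A - ?B) \<le> measure_pmf.prob D (- ?B)"
    by (rule measure_pmf.finite_measure_mono) auto
  moreover have "measure_pmf.prob D (- ?B) = 1 - measure_pmf.prob D ?B"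
    using measure_pmf.prob_compl[of ?B D] by (simp add: Compl_eq_Diff_UNIV)
  moreover have "measure_pmf.prob D (?A \<inter> ?B) \<le> measure_pmf.prob D {t. (r, \<phi> r) \<in> queried_on t ?x}"
  proof (rule measure_pmf.finite_measure_mono)
    show "?A \<inter> ?B \<subseteq> {t. (r, \<phi> r) \<in> queried_on t ?x}"
      using dtree_value_cong[of _ ?x ?y] by fastforce
  qed simp
  ultimately show ?thesis using AB by linarith
qed

text \<open>Averaging over random inputs, in the manner of Yao: the expected number of hits is at
  least n/3, whereas each tree in the support averages at most 2T / (n - 1).\<close>

lemma R2_has_full_row_ge:
  assumes "n \<ge> 2" "rdtree_cost_le (edges n) D T" "bounded_error_computes (edges n) D (has_full_row n)"
  shows "n * (n - 1) \<le> 6 * T"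
proof -
  let ?h = "\<lambda>t \<phi> r. (r, \<phi> r) \<in> queried_on t (one_missing n \<phi>)"
  let ?F = "\<lambda>t. \<Sum>\<phi>\<in>choices n. \<Sum>r<n. indicator {t. ?h t \<phi> r} t :: real"
  have card_pos: "card (choices n) > 0"
  proof -
    have "{..<n} - {i} \<noteq> {}" for i
    proof -
      have "(if i = 0 then 1 else 0) \<in> {..<n} - {i}" using assms(1) by auto
      then show ?thesis by blast
    qed
    then have "choices n \<noteq> {}" by (simp add: PiE_eq_empty_iff)
    then show ?thesis using finite_choices by (simp add: card_gt_0_iff)
  qed
  have int: "integrable (measure_pmf D) (\<lambda>t. indicator {t. ?h t \<phi> r} t :: real)" for \<phi> r
    by (rule measure_pmf.integrable_const_bound[where B = 1]) auto
  have "real (card (choices n)) * real n * (1 / 3) = (\<Sum>\<phi>\<in>choices n. \<Sum>r<n. 1 / 3 :: real)" by simp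
  also have "\<dots> \<le> (\<Sum>\<phi>\<in>choices n. \<Sum>r<n. measure_pmf.prob D {t. ?h t \<phi> r})"
    by (intro sum_mono hit_prob_ge assms(3)) auto
  also have "\<dots> = (\<Sum>\<phi>\<in>choices n. \<Sum>r<n. measure_pmf.expectation D (indicator {t. ?h t \<phi> r}))"
    by simp
  also have "\<dots> = measure_pmf.expectation D ?F"
    using int by (subst Bochner_Integration.integral_sum, force, subst Bochner_Integration.integral_sum) auto
  also have "\<dots> \<le> real (2 * T * card (choices n)) / real (n - 1)"
  proof (rule measure_pmf.integral_le_const)
    show "integrable (measure_pmf D) ?F" using int by (intro Bochner_Integration.integrable_sum)
    have "?F t \<le> real (2 * T * card (choices n)) / real (n - 1)" if "t \<in> set_pmf D" for t
    proof -
      have "(n - 1) * (\<Sum>\<phi>\<in>choices n. \<Sum>r<n. of_bool (?h t \<phi> r)) \<le> 2 * T * card (choices n)"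
        using sum_hits_le[OF assms(1), of t T] assms(2) that by (auto simp: rdtree_cost_le_def)
      then have "real ((n - 1) * (\<Sum>\<phi>\<in>choices n. \<Sum>r<n. of_bool (?h t \<phi> r))) \<le> real (2 * T * card (choices n))"
        by (simp only: of_nat_le_iff)
      moreover have "?F t = real (\<Sum>\<phi>\<in>choices n. \<Sum>r<n. of_bool (?h t \<phi> r))"
        by (simp add: indicator_def)
      ultimately show ?thesis using assms(1) by (simp add: field_simps of_nat_diff)
    qed
    then show "AE t in measure_pmf D. ?F t \<le> real (2 * T * card (choices n)) / real (n - 1)"
      by (simp add: AE_measure_pmf_iff)
  qed
  finally have "real (card (choices n)) * (real n * (real n - 1)) \<le> real (card (choices n)) * (6 * real T)"
    using assms(1) by (simp add: field_simps of_nat_diff)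
  then have "real n * (real n - 1) \<le> 6 * real T" using card_pos by simp
  then have "real (n * (n - 1)) \<le> real (6 * T)" using assms(1) by (simp add: of_nat_diff)
  then show ?thesis by (simp only: of_nat_le_iff)
qed

section \<open>Existence of optimal decision trees, and full rows as a graph property\<close>

lemma dtree_exists:
  assumes "finite S"
  shows "\<exists>t. queried t \<subseteq> S \<and> (\<forall>x. dtree_value t x = f (x \<inter> S)) \<and> (\<forall>x. dtree_cost t x \<le> card S)"
  using assms
proof (induction S arbitrary: f rule: finite_induct)
  case empty
  show ?case by (intro exI[of _ "Leaf (f {})"]) simp
next
  case (insert j S)
  obtain t0 where t0: "queried t0 \<subseteq> S" "\<And>x. dtree_value t0 x = f (x \<inter> S)" "\<And>x. dtree_cost t0 x \<le> card S"
    using insert.IH[of f] by auto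
  obtain t1 where t1: "queried t1 \<subseteq> S" "\<And>x. dtree_value t1 x = f (insert j (x \<inter> S))" "\<And>x. dtree_cost t1 x \<le> card S"
    using insert.IH[of "\<lambda>x. f (insert j x)"] by auto
  show ?case
    using t0 t1 insert.hyps by (intro exI[of _ "Query j t0 t1"]) auto
qed

lemma R2_attained:
  assumes "finite I"
  shows "\<exists>D. is_rdtree I D \<and> rdtree_cost_le I D (R2 I f) \<and> bounded_error_computes I D f"
proof -
  obtain t where "queried t \<subseteq> I" "\<And>x. dtree_value t x = f (x \<inter> I)" "\<And>x. dtree_cost t x \<le> card I"
    using dtree_exists[OF assms, of f] by blast
  then have D: "is_rdtree I (return_pmf t) \<and> rdtree_cost_le I (return_pmf t) (card I) \<and>
      bounded_error_computes I (return_pmf t) f"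
    by (auto simp: is_rdtree_def rdtree_cost_le_def bounded_error_computes_def Int_absorb2)
  let ?Q = "\<lambda>T. \<exists>D. is_rdtree I D \<and> rdtree_cost_le I D T \<and> bounded_error_computes I D f"
  have "?Q (card I)" using D by (rule exI)
  then have "?Q (LEAST T. ?Q T)" by (rule LeastI)
  then show ?thesis unfolding R2_def .
qed

lemma has_full_row_nonconstant_monotone_graph_property:
  assumes "n \<ge> 2"
  shows "nonconstant_monotone_graph_property n (has_full_row n)"
  unfolding nonconstant_monotone_graph_property_def
proof (intro conjI)
  have *: "has_full_row n (map_prod \<pi> \<pi> ` G)" if \<pi>: "\<pi> permutes {..<n}" and G: "has_full_row n G" for \<pi> G
  proof -
    obtain i where i: "i < n" "{i} \<times> ({..<n} - {i}) \<subseteq> G" using G by (auto simp: has_full_row_def)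
    have "{\<pi> i} \<times> ({..<n} - {\<pi> i}) \<subseteq> map_prod \<pi> \<pi> ` G"
    proof
      fix e assume "e \<in> {\<pi> i} \<times> ({..<n} - {\<pi> i})"
      then obtain j where j: "j < n" "j \<noteq> \<pi> i" and e: "e = (\<pi> i, j)" by auto
      have "j \<in> \<pi> ` {..<n}" using permutes_image[OF \<pi>] j(1) by simp
      then obtain k where k: "j = \<pi> k" "k < n" by auto
      then have "(i, k) \<in> G" using i j(2) by auto
      then have "map_prod \<pi> \<pi> (i, k) \<in> map_prod \<pi> \<pi> ` G" by (rule imageI)
      then show "e \<in> map_prod \<pi> \<pi> ` G" by (simp add: e k(1))
    qed
    moreover have "\<pi> i < n" using \<pi> i(1) permutes_in_image[of \<pi> "{..<n}" i] by simp
    ultimately show ?thesis unfolding has_full_row_def by blast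
  qed
  show "graph_property n (has_full_row n)"
    unfolding graph_property_def
  proof (intro allI impI iffI)
    fix \<pi> G assume \<pi>: "\<pi> permutes {..<n}" and full: "has_full_row n (map_prod \<pi> \<pi> ` G)"
    have "has_full_row n (map_prod (inv \<pi>) (inv \<pi>) ` map_prod \<pi> \<pi> ` G)"
      by (rule *[OF permutes_inv[OF \<pi>] full])
    moreover have "map_prod (inv \<pi>) (inv \<pi>) (map_prod \<pi> \<pi> e) = e" for e
      using permutes_inverses[OF \<pi>] by (cases e) simp
    then have "map_prod (inv \<pi>) (inv \<pi>) ` map_prod \<pi> \<pi> ` G = G"
      by (simp add: image_image)
    ultimately show "has_full_row n G" by simp
  qed (use * in simp)
  show "monotone_property n (has_full_row n)"
    unfolding monotone_property_def has_full_row_def by (meson subset_trans)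
  have "has_full_row n (edges n)"
    unfolding has_full_row_def using assms by (intro exI[of _ 0]) (auto simp: edges_def)
  moreover have "\<not> has_full_row n {}"
  proof
    assume "has_full_row n {}"
    then obtain i where "i < n" "{..<n} - {i} = {}" by (auto simp: has_full_row_def)
    then have "card {..<n} \<le> card {i}" by (intro card_mono) auto
    then show False using assms by simp
  qed
  ultimately show "nonconstant_property n (has_full_row n)"
    unfolding nonconstant_property_def by (meson empty_subsetI subset_refl)
qed

section \<open>Zero-error quantum algorithm for full rows\<close>

text \<open>The current row number is the outcome that selects the next search; once all rows are
  done, the remaining searches are idle queries.\<close>

lemma runs_walk:
  assumes "finite I" "\<And>i. i < n \<Longrightarrow> runs I T (UNIV :: bool set) (p i)"
  shows "runs I (k * T) {..n} (\<lambda>x. walk n (\<lambda>i. p i x True) k)"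
proof (induction k)
  case 0
  show ?case using runs_return[of "{..n}" 0 I] by (simp add: fun_eq_iff)
next
  case (Suc k)
  define st where "st l x i = (if l < n then p l x True * of_bool (i = Suc l) + (1 - p l x True) * of_bool (i = l) else of_bool (i = l))" for l i :: nat and x
  have "runs I T {..n} (st l)" if "l \<in> {..n}" for l
  proof (cases "l < n")
    case True
    have *: "runs I (T + 0) {..n} (\<lambda>x i. \<Sum>b\<in>UNIV. p l x b * of_bool (i = (if b then Suc l else l)))"
      using assms True by (intro runs_bind runs_return) auto
    have "p l x False = 1 - p l x True" for x
      using runs_prob(2)[OF assms(2)[OF True], of x] by (simp add: UNIV_bool)
    then have "runs I (T + 0) {..n} (st l)"
      using True by (intro runs_cong[OF *]) (simp add: st_def UNIV_bool del: sum_mult_of_bool_eq)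
    then show ?thesis by simp
  next
    case False
    have "runs I T {..n} (\<lambda>x i. of_bool (i = l))"
      by (rule runs_idle[OF runs_return]) (use that assms(1) in auto)
    then show ?thesis by (rule runs_cong) (simp add: st_def False)
  qed
  then have "runs I (k * T + T) {..n} (\<lambda>x i. \<Sum>l\<le>n. walk n (\<lambda>i. p i x True) k l * st l x i)"
    using Suc assms(1) by (intro runs_bind) auto
  then show ?case by (simp add: st_def add.commute)
qed

text \<open>The walk moves on from row \<open>i\<close> when a search finds a missing edge in it. After \<open>16 n\<close> searches it has
  probably reached the first full row, which it cannot leave, and all edges of the current row are queried.\<close>

lemma Q0_has_full_row_le:
  assumes "n \<ge> 2" "sqrt n \<le> real m"
  shows "Q0 (edges n) (has_full_row n) \<le> 16 * n * (m + 1) + n"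
proof -
  define row where "row i = {i} \<times> ({..<n} - {i})" for i
  have row: "row i \<subseteq> edges n" "card (row i) = n - 1" "row i \<noteq> {}" if "i < n" for i
  proof -
    show "row i \<subseteq> edges n" using that by (auto simp: row_def edges_def)
    show card: "card (row i) = n - 1" using that by (simp add: row_def card_cartesian_product)
    then show "row i \<noteq> {}" using assms(1) by force
  qed
  have m: "m > 0" "sqrt (n - 1) \<le> real m"
  proof -
    have "sqrt (n - 1) \<le> sqrt n" by simp
    then show "sqrt (n - 1) \<le> real m" using assms(2) by linarith
    have "sqrt n > 0" using assms(1) by simp
    then have "real m > 0" using assms(2) by linarith
    then show "m > 0" by simp
  qed
  have "\<exists>p. runs (edges n) (m + 1) (UNIV :: bool set) p \<and>
    (\<forall>x. (row i \<subseteq> x \<longrightarrow> p x True = 0) \<and> (\<not> row i \<subseteq> x \<longrightarrow> p x True \<ge> 1 / 8))" if "i < n" for i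
    using row[OF that] m by (intro runs_search finite_edges) auto
  then obtain p where p: "\<And>i. i < n \<Longrightarrow> runs (edges n) (m + 1) (UNIV :: bool set) (p i)"
    and p_full: "\<And>i x. i < n \<Longrightarrow> row i \<subseteq> x \<Longrightarrow> p i x True = 0"
    and p_not_full: "\<And>i x. i < n \<Longrightarrow> \<not> row i \<subseteq> x \<Longrightarrow> p i x True \<ge> 1 / 8"
    by metis
  define W where "W x = walk n (\<lambda>i. p i x True) (16 * n)" for x
  \<comment> \<open>Being at \<open>n\<close> certifies a missing edge in every row. At any other
    row, the only definite answer is \<open>True\<close>, and reading the row justifies it.\<close>
  define fin where "fin i x v = (of_bool (v =
      (if i = n then Some False else if row i \<subseteq> x then Some True else None)) :: real)" for i x v
  have "runs (edges n) n UNIV (fin i)" if "i \<in> {..n}" for i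
  proof (cases "i = n")
    case True
    have "runs (edges n) n UNIV (\<lambda>x v. of_bool (v = Some False))"
      by (rule runs_idle[OF runs_return]) (auto simp: finite_edges)
    then show ?thesis by (rule runs_cong) (simp add: fin_def True)
  next
    case False
    then have i: "i < n" using that by simp
    have finr: "finite (row i)" by (simp add: row_def)
    have "runs (edges n) (card (row i) + 0) UNIV (\<lambda>x v. \<Sum>u\<in>Pow (row i).
        of_bool (u = x \<inter> row i) * of_bool (v = (if u = row i then Some True else None)))"
      using row(1)[OF i] finr by (intro runs_bind runs_query_all runs_return finite_edges) auto
    then have "runs (edges n) (card (row i) + 0) UNIV (fin i)"
    proof (rule runs_cong)
      fix x v
      have "(\<Sum>u\<in>Pow (row i). of_bool (u = x \<inter> row i) * of_bool (v = (if u = row i then Some True else None))) =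
          (\<Sum>u\<in>Pow (row i). if u = x \<inter> row i then of_bool (v = (if u = row i then Some True else None)) else (0 :: real))"
        by (intro sum.cong) auto
      also have "\<dots> = of_bool (v = (if x \<inter> row i = row i then Some True else None))"
        using finr by simp
      also have "\<dots> = fin i x v" using False by (simp add: fin_def Int_absorb1 inf.absorb_iff2)
      finally show "(\<Sum>u\<in>Pow (row i). of_bool (u = x \<inter> row i) * of_bool (v = (if u = row i then Some True else None))) = fin i x v" .
    qed
    then show ?thesis by (rule runs_idle) (use row(2)[OF i] finite_edges in auto)
  qed
  then have runs: "runs (edges n) (16 * n * (m + 1) + n) UNIV (\<lambda>x v. \<Sum>i\<le>n. W x i * fin i x v)"
    unfolding W_def using runs_walk[OF finite_edges p] by (intro runs_bind) (auto simp: finite_edges)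
  show ?thesis
  proof (rule Q0_le(1))
    show "runs (edges n) (16 * n * (m + 1) + n) UNIV (\<lambda>x v. \<Sum>i\<le>n. W x i * fin i x v)" by (rule runs)
    show "finite (edges n)" "edges n \<noteq> {}"
      using finite_edges row(1,3)[of 0] assms(1) by auto
    fix x :: "(nat \<times> nat) set"
    have p01: "0 \<le> p i x True \<and> p i x True \<le> 1" if "i < n" for i
      using runs_prob(1)[OF p[OF that], where v = True and x = x] runs_prob(1)[OF p[OF that], where v = False and x = x]
        runs_prob(2)[OF p[OF that], of x] by (simp add: UNIV_bool)
    define r where "r = (if has_full_row n x then LEAST i. i < n \<and> row i \<subseteq> x else n)"
    have full: "has_full_row n x \<longleftrightarrow> (\<exists>i. i < n \<and> row i \<subseteq> x)" by (auto simp: has_full_row_def row_def)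
    have r: "r \<le> n" "r < n \<longleftrightarrow> has_full_row n x" "r < n \<Longrightarrow> row r \<subseteq> x" "\<And>i. i < r \<Longrightarrow> \<not> row i \<subseteq> x"
    proof -
      have "r < n \<and> row r \<subseteq> x" if "has_full_row n x"
        using LeastI_ex[of "\<lambda>i. i < n \<and> row i \<subseteq> x"] that full by (simp add: r_def)
      moreover have "r = n" if "\<not> has_full_row n x" using that by (simp add: r_def)
      ultimately show "r \<le> n" "r < n \<longleftrightarrow> has_full_row n x" "r < n \<Longrightarrow> row r \<subseteq> x" by force+
      then show "\<not> row i \<subseteq> x" if "i < r" for i
        using not_less_Least[of i "\<lambda>i. i < n \<and> row i \<subseteq> x"] that full by (auto simp: r_def split: if_splits)
    qed
    have W: "W x i \<ge> 0" for i
      unfolding W_def using p01 by (rule walk_nonneg)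
    have W_beyond: "W x i = 0" if "r < i" "i \<le> n" for i
      unfolding W_def using p01 p_full r(3) that by (intro walk_beyond_eq_0) auto
    have "real (16 * n) * (\<Sum>i<r. W x i) \<le> 8 * real n"
      unfolding W_def using p01 p_full p_not_full r by (intro walk_before_le) auto
    \<comment> \<open>The reason for 16 n searches: the walk is still before \<open>r\<close> with
      probability at most 8n / 16n.\<close>
    then have W_before: "(\<Sum>i<r. W x i) \<le> 1 / 2"
      using assms(1) by (simp add: field_simps)
    show "(\<Sum>i\<le>n. W x i * fin i x (Some (\<not> has_full_row n x))) = 0"
    proof (intro sum.neutral ballI)
      fix i assume i: "i \<in> {..n}"
      show "W x i * fin i x (Some (\<not> has_full_row n x)) = 0"
      proof (cases "has_full_row n x")
        case True
        then have "W x n = 0" using r(2) by (intro W_beyond) auto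
        then show ?thesis using True by (simp add: fin_def)
      next
        case False
        then show ?thesis using i full by (auto simp: fin_def)
      qed
    qed
    \<comment> \<open>"Don't know" arises only before \<open>r\<close>: the walk cannot pass
      \<open>r\<close>, and at \<open>r\<close> itself the answer is definite.\<close>
    have "(\<Sum>i\<le>n. W x i * fin i x None) = (\<Sum>i<r. W x i * fin i x None)"
    proof (intro sum.mono_neutral_right ballI)
      fix i assume "i \<in> {..n} - {..<r}"
      then consider "r < i" "i \<le> n" | "i = r" "r < n" | "i = n" by force
      then show "W x i * fin i x None = 0"
        by cases (use W_beyond r(3) in \<open>auto simp: fin_def\<close>)
    qed (use r(1) in auto)
    also have "\<dots> \<le> (\<Sum>i<r. W x i)"
      by (intro sum_mono mult_left_le W) (simp add: fin_def)
    finally show "(\<Sum>i\<le>n. W x i * fin i x None) \<le> 1 / 2"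
      using W_before by simp
  qed
qed

theorem theorem14:
  shows "(\<exists>c>0. \<forall>\<^sub>F n in sequentially. \<forall>P.
            nonconstant_monotone_graph_property n P \<longrightarrow> real (Q0 (edges n) P) \<ge> c * real n) \<and>
         (\<exists>P :: nat \<Rightarrow> (nat \<times> nat) set \<Rightarrow> bool.
            (\<forall>n\<ge>2. nonconstant_monotone_graph_property n (P n)) \<and>
            (\<lambda>n. real (Q0 (edges n) (P n))) \<in> O(\<lambda>n. real n powr (3 / 2)) \<and>
            (\<lambda>n. real (R2 (edges n) (P n))) \<in> \<Omega>(\<lambda>n. (real n)\<^sup>2))"
proof (intro conjI)
  show "\<exists>c>0. \<forall>\<^sub>F n in sequentially. \<forall>P.
      nonconstant_monotone_graph_property n P \<longrightarrow> real (Q0 (edges n) P) \<ge> c * real n"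
  proof (intro exI[of _ "1 / 2"] conjI)
    show "\<forall>\<^sub>F n in sequentially. \<forall>P.
      nonconstant_monotone_graph_property n P \<longrightarrow> real (Q0 (edges n) P) \<ge> 1 / 2 * real n"
      using eventually_ge_at_top[of 2]
    proof eventually_elim
      case (elim n)
      have "(0, 1) \<in> edges n" using elim by (simp add: edges_def)
      then have ne: "edges n \<noteq> {}" by blast
      show ?case
      proof (intro allI impI)
        fix P assume P: "nonconstant_monotone_graph_property n P"
        obtain A where "is_qalg (edges n) A" "num_queries A = Q0 (edges n) P" "zero_error_computes (edges n) A P"
          using Q0_attained[OF finite_edges ne, of P] by blast
        with Q0_graph_property_ge[OF P elim] have "n - 1 \<le> Q0 (edges n) P" by metis
        then show "real (Q0 (edges n) P) \<ge> 1 / 2 * real n" using elim by linarith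
      qed
    qed
  qed simp
  show "\<exists>P :: nat \<Rightarrow> (nat \<times> nat) set \<Rightarrow> bool.
      (\<forall>n\<ge>2. nonconstant_monotone_graph_property n (P n)) \<and>
      (\<lambda>n. real (Q0 (edges n) (P n))) \<in> O(\<lambda>n. real n powr (3 / 2)) \<and>
      (\<lambda>n. real (R2 (edges n) (P n))) \<in> \<Omega>(\<lambda>n. (real n)\<^sup>2)"
  proof (intro exI[of _ has_full_row] conjI allI impI)
    show "nonconstant_monotone_graph_property n (has_full_row n)" if "n \<ge> 2" for n
      by (rule has_full_row_nonconstant_monotone_graph_property[OF that])
    show "(\<lambda>n. real (Q0 (edges n) (has_full_row n))) \<in> O(\<lambda>n. real n powr (3 / 2))"
    \<comment> \<open>With m at most sqrt n + 1, 16 (m + 1) + 1 is at most 16 sqrt n + 33, hence at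
      most 49 sqrt n.\<close>
    proof (rule bigoI[where c = 49])
      show "\<forall>\<^sub>F n in sequentially. norm (real (Q0 (edges n) (has_full_row n))) \<le> 49 * norm (real n powr (3 / 2))"
        using eventually_ge_at_top[of 2]
      proof eventually_elim
        case (elim n)
        define m where "m = nat \<lceil>sqrt n\<rceil>"
        have m: "sqrt n \<le> real m" "real m \<le> sqrt n + 1" by (simp_all add: m_def)
        have "1 \<le> sqrt n" using elim by simp
        have coeff: "16 * (a + 1) + 1 \<le> 49 * b" if "a \<le> b + 1" "1 \<le> b" for a b :: real
          using that by (simp add: algebra_simps)
        have "real (Q0 (edges n) (has_full_row n)) \<le> real (16 * n * (m + 1) + n)"
          using Q0_has_full_row_le[OF elim m(1)] by (simp only: of_nat_le_iff)
        also have "\<dots> = real n * (16 * (real m + 1) + 1)" by (simp add: algebra_simps)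
        also have "\<dots> \<le> real n * (49 * sqrt n)"
          using coeff[OF m(2)] \<open>1 \<le> sqrt n\<close> by (intro mult_left_mono) auto
        also have "real n * (49 * sqrt n) = 49 * real n powr (3 / 2)"
        proof -
          have "real n powr (3 / 2) = real n powr (1 + 1 / 2)" by simp
          also have "\<dots> = real n * sqrt n" using elim by (simp only: powr_add powr_half_sqrt) simp
          finally show ?thesis by simp
        qed
        finally show ?case by simp
      qed
    qed
    show "(\<lambda>n. real (R2 (edges n) (has_full_row n))) \<in> \<Omega>(\<lambda>n. (real n)\<^sup>2)"
    \<comment> \<open>The 6 of \<open>R2_has_full_row_ge\<close>, doubled since n is at most 2 (n -
      1).\<close>
    proof (rule landau_omega.bigI[where c = "1 / 12"])
      show "\<forall>\<^sub>F n in sequentially. norm (real (R2 (edges n) (has_full_row n))) \<ge> 1 / 12 * norm ((real n)\<^sup>2)"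
        using eventually_ge_at_top[of 2]
      proof eventually_elim
        case (elim n)
        obtain D where "rdtree_cost_le (edges n) D (R2 (edges n) (has_full_row n))"
            "bounded_error_computes (edges n) D (has_full_row n)"
          using R2_attained[OF finite_edges, of n "has_full_row n"] by blast
        from R2_has_full_row_ge[OF elim this]
        have "real (n * (n - 1)) \<le> real (6 * R2 (edges n) (has_full_row n))" by (simp only: of_nat_le_iff)
        moreover have "real n * real n \<le> real n * (2 * real (n - 1))"
          using elim by (intro mult_left_mono) auto
        ultimately show ?case by (simp add: power2_eq_square)
      qed
    qed simp
  qed
qed

end
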